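(* Let $G$ be a $\sigma$-compact locally compact Abelian group and let $\mathcal{A}=\{A_n\mid n\in\mathbb{N}\}$ be a fixed averaging sequence in $G$. Let $S\subset G$ be countable, $w:S\to\mathbb{C}$, and let $\omega=\sum_{x\in S}w(x)\,\delta_x$ be a complex regular Borel measure on $G$. Assume: (1) $\omega$ is translation bounded; (2) for every $z\in\Delta:=S-S$ the limit $\eta(z)=\lim_{n\to\infty}\eta_n(z)$ exists, where $\eta_n(z)=\frac{1}{\theta(A_n)}\sum_{x,y\in S\cap A_n,\ x-y=z}w(x)\overline{w(y)}$ (and $\eta(z):=0$ for $z\notin\Delta$), and $\eta(0)>0$; (3$^+$) $\Delta$ is closed and discrete in $G$, and $\Delta^{\rm ess}:=\{z\in G\mid\eta(z)\neq 0\}$ is uniformly discrete; (4) for every $\varepsilon>0$ the set $P_\varepsilon=\{t\in G\mid |1-\eta(t)/\eta(0)|^{1/2}<\varepsilon\}$ is relatively dense in $G$. Let $\gamma_\omega=\sum_{z\in\Delta}\eta(z)\,\delta_z$ be the autocorrelation measure of $\omega$ relative to $\mathcal{A}$. Then the diffraction measure $\hat\gamma_\omega$, i.e. the Fourier transform of $\gamma_\omega$, on the dual group $\hat G$ is a translation bounded, positive pure point measure.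
   Context: Locally compact Abelian (LCA) groups are Hausdorff and written additively; $\theta$ is a fixed Haar measure on $G$, and $\hat G$ carries the matching Haar measure (for which Plancherel holds). $\mathcal{K}(G)$ is the space of continuous complex-valued functions on $G$ with compact support. A measure is a continuous complex-valued linear functional on $\mathcal{K}(G)$, identified with a regular Borel measure; it may be unbounded. $\delta_x$ is the unit point mass at $x$. Averaging sequence: a countable family of relatively compact open sets $A_n\subset G$ with $A_1\neq\varnothing$, $\overline{A_n}\subset A_{n+1}$ for all $n$, and $\bigcup_n A_n=G$. A measure $\mu$ is translation bounded if for each compact $K\subset G$ one has $\sup_{t\in G}|\mu|(t+K)<\infty$, where $|\mu|$ is the total variation measure. A set $P\subset G$ is uniformly discrete if there is an open neighbourhood $V$ of $0$ with $(t+V)\cap P=\{t\}$ for all $t\in P$; it is relatively dense if there is a compact $K\subset G$ with $P+K=G$. For $g\in\mathcal{K}(G)$ put $\tilde g(x)=\overline{g(-x)}$, and for a measure $\mu$ put $\tilde\mu(g)=\overline{\mu(\tilde g)}$. With $\omega_n=\omega|_{A_n}$, the autocorrelation of $\omega$ relative to $\mathcal{A}$ is the vague limit of $\gamma_\omega^{(n)}=\frac{\omega_n*\tilde\omega_n}{\theta(A_n)}=\sum_{z\in\Delta}\eta_n(z)\delta_z$; if $\omega=\sum_{x\in S}w(x)\,\delta_x$ (with $S\subset G$ countable and $w:S\to\mathbb{C}$) is a translation bounded measure, if for every $z\in\Delta=S-S$ the limit $\eta(z)=\lim_{n\to\infty}\eta_n(z)$ exists, where $\eta_n(z)=\frac{1}{\theta(A_n)}\sum_{x,y\in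 S\cap A_n,\ x-y=z}w(x)\overline{w(y)}$, and if $\Delta$ is closed and discrete in $G$, then it exists and equals $\sum_{z\in\Delta}\eta(z)\delta_z$. It is a positive definite measure (i.e. $\gamma_\omega(g*\tilde g)\ge 0$ for all $g\in\mathcal{K}(G)$), and its Fourier transform $\hat\gamma_\omega$ is the unique positive measure on $\hat G$ with $\gamma_\omega(g*\tilde g)=\int_{\hat G}|\hat g(-k)|^2\,d\hat\gamma_\omega(k)$ for all $g\in\mathcal{K}(G)$, where $\hat g$ is the usual Fourier transform on $L^1(G)$. *)

theory Defs
  imports "HOL-Analysis.Analysis"
begin

section \<open>The dual group\<close>

typedef (overloaded) ('a::topological_ab_group_add) dual_group =
  "{a :: 'a \<Rightarrow> complex. continuous_on UNIV a \<and> (\<forall>x. norm (a x) = 1) \<and>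
      (\<forall>x y. a (x + y) = a x * a y)}"
  morphisms char_app Abs_dual_group
  by (rule exI[of _ "\<lambda>_. 1"]) auto

setup_lifting type_definition_dual_group

lemma char_continuous: "continuous_on UNIV (char_app k)"
  and char_norm [simp]: "norm (char_app k x) = 1"
  and char_add: "char_app k (x + y) = char_app k x * char_app k y"
  using char_app[of k] by auto

instantiation dual_group :: (topological_ab_group_add) ab_group_add
begin

lift_definition zero_dual_group :: "'a dual_group" is "\<lambda>_. 1" by auto

lift_definition plus_dual_group :: "'a dual_group \<Rightarrow> 'a dual_group \<Rightarrow> 'a dual_group"
  is "\<lambda>a b x. a x * b x"
  by (auto intro!: continuous_intros simp: norm_mult)

lift_definition uminus_dual_group :: "'a dual_group \<Rightarrow> 'a dual_group"
  is "\<lambda>a x. cnj (a x)"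
  by (auto intro!: continuous_intros)

lift_definition minus_dual_group :: "'a dual_group \<Rightarrow> 'a dual_group \<Rightarrow> 'a dual_group"
  is "\<lambda>a b x. a x * cnj (b x)"
  by (auto intro!: continuous_intros simp: norm_mult)

instance
proof
  fix a :: "'a dual_group"
  show "- a + a = 0"
    by transfer (auto simp: fun_eq_iff mult.commute complex_norm_square[symmetric])
qed (transfer; simp add: mult_ac fun_eq_iff)+

end

definition char_near :: "'a::topological_ab_group_add set \<Rightarrow> real \<Rightarrow> 'a dual_group \<Rightarrow> 'a dual_group \<Rightarrow> bool" where
  "char_near K e k l \<longleftrightarrow> (\<forall>x\<in>K. dist (char_app k x) (char_app l x) < e)"

text \<open>
  Uniform convergence on compact sets, which for continuous functions into a metric space
  is the compact-open topology.
\<close>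

instantiation dual_group :: (topological_ab_group_add) topological_space
begin

definition open_dual_group :: "'a dual_group set \<Rightarrow> bool" where
  "open_dual_group W \<longleftrightarrow>
     (\<forall>k\<in>W. \<exists>K e. compact K \<and> e > 0 \<and> (\<forall>l. char_near K e k l \<longrightarrow> l \<in> W))"

instance
proof
  show "open (UNIV :: 'a dual_group set)"
    unfolding open_dual_group_def by (intro ballI exI[of _ "{}"] exI[of _ 1]) auto
next
  fix S T :: "'a dual_group set"
  assume S: "open S" and T: "open T"
  show "open (S \<inter> T)"
    unfolding open_dual_group_def
  proof
    fix k assume k: "k \<in> S \<inter> T"
    obtain K e where 1: "compact K" "e > 0" "\<forall>l. char_near K e k l \<longrightarrow> l \<in> S"
      using S k unfolding open_dual_group_def by blast
    obtain L d where 2: "compact L" "d > 0" "\<forall>l. char_near L d k l \<longrightarrow> l \<in> T"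
      using T k unfolding open_dual_group_def by blast
    have "\<forall>l. char_near (K \<union> L) (min e d) k l \<longrightarrow> l \<in> S \<inter> T"
      using 1(3) 2(3) unfolding char_near_def by auto
    then show "\<exists>K e. compact K \<and> e > 0 \<and> (\<forall>l. char_near K e k l \<longrightarrow> l \<in> S \<inter> T)"
      using 1 2 by (intro exI[of _ "K \<union> L"] exI[of _ "min e d"]) (auto intro: compact_Un)
  qed
next
  fix \<K> :: "'a dual_group set set"
  assume *: "\<forall>B\<in>\<K>. open B"
  show "open (\<Union>\<K>)"
    unfolding open_dual_group_def
  proof
    fix k assume "k \<in> \<Union>\<K>"
    then obtain B where B: "B \<in> \<K>" "k \<in> B" by blast
    with * obtain K e where "compact K" "e > 0" "\<forall>l. char_near K e k l \<longrightarrow> l \<in> B"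
      unfolding open_dual_group_def by blast
    with B show "\<exists>K e. compact K \<and> e > 0 \<and> (\<forall>l. char_near K e k l \<longrightarrow> l \<in> \<Union>\<K>)"
      by blast
  qed
qed

end

lemma eventually_nhds_dual_group:
  "eventually P (nhds k) \<longleftrightarrow> (\<exists>K e. compact K \<and> e > 0 \<and> (\<forall>l. char_near K e k l \<longrightarrow> P l))"
    (is "_ \<longleftrightarrow> ?R k")
proof
  assume "eventually P (nhds k)"
  then show "?R k"
    unfolding eventually_nhds open_dual_group_def by meson
next
  assume R: "?R k"
  have "open {k. ?R k}"
    unfolding open_dual_group_def
  proof
    fix k assume "k \<in> {k. ?R k}"
    then obtain K e where K: "compact K" "e > 0" "\<And>l. char_near K e k l \<Longrightarrow> P l" by blast
    have "?R l" if "char_near K (e / 2) k l" for l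
    proof (intro exI conjI allI impI)
      fix m assume "char_near K (e / 2) l m"
      with that have "char_near K e k m"
        unfolding char_near_def using dist_triangle_half_r dist_commute by metis
      then show "P m" by (rule K)
    qed (use K in auto)
    then show "\<exists>K e. compact K \<and> e > 0 \<and> (\<forall>l. char_near K e k l \<longrightarrow> l \<in> {k. ?R k})"
      using K by (intro exI[of _ K] exI[of _ "e / 2"]) auto
  qed
  moreover have "\<forall>k\<in>{k. ?R k}. P k" unfolding char_near_def by auto
  ultimately show "eventually P (nhds k)"
    unfolding eventually_nhds using R by blast
qed

instance dual_group :: (topological_ab_group_add) t2_space
proof
  fix k l :: "'a dual_group"
  assume "k \<noteq> l"
  then obtain x where x: "char_app k x \<noteq> char_app l x"
    by (auto simp flip: char_app_inject)
  define e where "e = dist (char_app k x) (char_app l x) / 2"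
  have e: "e > 0" using x by (simp add: e_def)
  have "eventually (\<lambda>m. dist (char_app k x) (char_app m x) < e) (nhds k)"
    unfolding eventually_nhds_dual_group char_near_def
    using e by (intro exI[of _ "{x}"] exI[of _ e]) auto
  then obtain U where U: "open U" "k \<in> U" "\<And>m. m \<in> U \<Longrightarrow> dist (char_app k x) (char_app m x) < e"
    unfolding eventually_nhds by blast
  have "eventually (\<lambda>m. dist (char_app l x) (char_app m x) < e) (nhds l)"
    unfolding eventually_nhds_dual_group char_near_def
    using e by (intro exI[of _ "{x}"] exI[of _ e]) auto
  then obtain V where V: "open V" "l \<in> V" "\<And>m. m \<in> V \<Longrightarrow> dist (char_app l x) (char_app m x) < e"
    unfolding eventually_nhds by blast
  have "U \<inter> V = {}"
  proof (rule ccontr)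
    assume "U \<inter> V \<noteq> {}"
    then obtain m where "m \<in> U" "m \<in> V" by blast
    then have "dist (char_app k x) (char_app m x) + dist (char_app l x) (char_app m x) < 2 * e"
      using U(3) V(3) by fastforce
    moreover have "dist (char_app k x) (char_app l x)
        \<le> dist (char_app k x) (char_app m x) + dist (char_app l x) (char_app m x)"
      by (metis dist_commute dist_triangle)
    ultimately show False by (simp add: e_def)
  qed
  with U V show "\<exists>U V. open U \<and> open V \<and> k \<in> U \<and> l \<in> V \<and> U \<inter> V = {}"
    by blast
qed

instance dual_group :: (topological_ab_group_add) topological_ab_group_add
proof
  fix k l :: "'a dual_group"
  show "LIM p (nhds k \<times>\<^sub>F nhds l). fst p + snd p :> nhds (k + l)"
    unfolding filterlim_iff
  proof (intro allI impI)
    fix P :: "'a dual_group \<Rightarrow> bool"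
    assume "eventually P (nhds (k + l))"
    then obtain K e where K: "compact K" "e > 0" "\<And>m. char_near K e (k + l) m \<Longrightarrow> P m"
      unfolding eventually_nhds_dual_group by blast
    have nbhd: "eventually (\<lambda>m. char_near K (e / 2) j m) (nhds j)" for j
      unfolding eventually_nhds_dual_group using K by (intro exI[of _ K] exI[of _ "e / 2"]) auto
    have "P (a + b)" if a: "char_near K (e / 2) k a" and b: "char_near K (e / 2) l b" for a b
    proof (rule K, unfold char_near_def, intro ballI)
      fix x assume x: "x \<in> K"
      have "dist (char_app (k + l) x) (char_app (a + b) x)
          = norm ((char_app k x - char_app a x) * char_app l x
                  + char_app a x * (char_app l x - char_app b x))"
        by (simp add: plus_dual_group.rep_eq dist_norm algebra_simps)
      also have "\<dots> \<le> norm (char_app k x - char_app a x) + norm (char_app l x - char_app b x)"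
        by (rule order_trans[OF norm_triangle_ineq]) (simp add: norm_mult)
      also have "\<dots> < e"
        using a b x unfolding char_near_def dist_norm by fastforce
      finally show "dist (char_app (k + l) x) (char_app (a + b) x) < e" .
    qed
    then show "eventually (\<lambda>p. P (fst p + snd p)) (nhds k \<times>\<^sub>F nhds l)"
      unfolding eventually_prod_filter using nbhd[of k] nbhd[of l]
      by (intro exI[of _ "char_near K (e / 2) k"] exI[of _ "char_near K (e / 2) l"]) auto
  qed
next
  fix k :: "'a dual_group"
  show "(uminus \<longlongrightarrow> - k) (nhds k)"
    unfolding filterlim_iff
  proof (intro allI impI)
    fix P :: "'a dual_group \<Rightarrow> bool"
    assume "eventually P (nhds (- k))"
    then obtain K e where K: "compact K" "e > 0" "\<And>m. char_near K e (- k) m \<Longrightarrow> P m"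
      unfolding eventually_nhds_dual_group by blast
    have "char_near K e (- k) (- a)" if "char_near K e k a" for a
      using that unfolding char_near_def dist_norm
      by (simp add: uminus_dual_group.rep_eq flip: complex_cnj_diff)
    with K show "eventually (\<lambda>a. P (- a)) (nhds k)"
      unfolding eventually_nhds_dual_group by blast
  qed
qed


section \<open>Positive measures on a topological group\<close>

text \<open>
  Inner regularity is required on all Borel sets, not only on open ones; on a
  \<open>\<sigma>\<close>-compact locally compact space this agrees with the convention
  ``outer regular, and inner regular on open sets''.  On spaces that need not be
  \<open>\<sigma>\<close>-compact, such as dual groups, this makes measures correspond
  one-to-one to positive linear functionals on the compactly supported functions and makes
  \<open>\<nu> B = (\<Sum>x\<in>B. \<nu> {x})\<close> the right description of pure pointness.
\<close>

definition radon_measure :: "'a::topological_space measure \<Rightarrow> bool" where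
  "radon_measure \<nu> \<longleftrightarrow>
     sets \<nu> = sets borel \<and>
     (\<forall>K. compact K \<longrightarrow> emeasure \<nu> K < \<infinity>) \<and>
     (\<forall>B\<in>sets borel. emeasure \<nu> B = (SUP K\<in>{K. compact K \<and> K \<subseteq> B}. emeasure \<nu> K))"

definition haar_measure :: "'a::{topological_space, ab_group_add} measure \<Rightarrow> bool" where
  "haar_measure \<theta> \<longleftrightarrow>
     radon_measure \<theta> \<and> emeasure \<theta> UNIV \<noteq> 0 \<and>
     (\<forall>t. \<forall>B\<in>sets borel. emeasure \<theta> ((+) t ` B) = emeasure \<theta> B)"

text \<open>A positive measure is its own total variation measure.\<close>

definition translation_bounded_pos :: "'a::{topological_space, ab_group_add} measure \<Rightarrow> bool" where
  "translation_bounded_pos \<nu> \<longleftrightarrow> (\<forall>K. compact K \<longrightarrow> (SUP t. emeasure \<nu> ((+) t ` K)) < \<infinity>)"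

definition pure_point :: "'a::topological_space measure \<Rightarrow> bool" where
  "pure_point \<nu> \<longleftrightarrow> (\<forall>B\<in>sets \<nu>. emeasure \<nu> B = (\<Sum>\<^sub>\<infinity>x\<in>B. emeasure \<nu> {x}))"


section \<open>Complex measures as functionals on the compactly supported functions\<close>

definition sigma_compact_space :: "'a::topological_space itself \<Rightarrow> bool" where
  "sigma_compact_space _ \<longleftrightarrow>
     (\<exists>C :: nat \<Rightarrow> 'a set. (\<forall>n. compact (C n)) \<and> (\<Union>n. C n) = UNIV)"

definition supp :: "('a::topological_space \<Rightarrow> complex) \<Rightarrow> 'a set" where
  "supp g = closure {x. g x \<noteq> 0}"

definition Kspace :: "('a::topological_space \<Rightarrow> complex) set" where
  "Kspace = {g. continuous_on UNIV g \<and> compact (supp g)}"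

text \<open>
  Functionals are total functions on all of \<open>'a \<Rightarrow> complex\<close>; only their
  values on \<open>Kspace\<close> matter.  Continuity refers to the inductive limit topology.
\<close>

definition complex_measure :: "(('a::topological_space \<Rightarrow> complex) \<Rightarrow> complex) \<Rightarrow> bool" where
  "complex_measure \<mu> \<longleftrightarrow>
     (\<forall>g\<in>Kspace. \<forall>h\<in>Kspace. \<mu> (\<lambda>x. g x + h x) = \<mu> g + \<mu> h) \<and>
     (\<forall>c. \<forall>g\<in>Kspace. \<mu> (\<lambda>x. c * g x) = c * \<mu> g) \<and>
     (\<forall>K. compact K \<longrightarrow>
        (\<exists>a. \<forall>g\<in>Kspace. supp g \<subseteq> K \<longrightarrow> norm (\<mu> g) \<le> a * (SUP x. norm (g x))))"

text \<open>
  The total variation measure \<open>|\<mu>|\<close> as constructed in the Riesz representation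
  theorem: first on open sets, then on arbitrary sets by outer regularity.
\<close>

definition total_variation ::
    "(('a::topological_space \<Rightarrow> complex) \<Rightarrow> complex) \<Rightarrow> 'a set \<Rightarrow> ennreal" where
  "total_variation \<mu> B =
     (INF U\<in>{U. open U \<and> B \<subseteq> U}.
        SUP g\<in>{g\<in>Kspace. supp g \<subseteq> U \<and> (\<forall>x. norm (g x) \<le> 1)}. ennreal (norm (\<mu> g)))"

definition translation_bounded ::
    "(('a::{topological_space, ab_group_add} \<Rightarrow> complex) \<Rightarrow> complex) \<Rightarrow> bool" where
  "translation_bounded \<mu> \<longleftrightarrow>
     (\<forall>K. compact K \<longrightarrow> (SUP t. total_variation \<mu> ((+) t ` K)) < \<infinity>)"

definition dirac_comb :: "'a set \<Rightarrow> ('a \<Rightarrow> complex) \<Rightarrow> ('a \<Rightarrow> complex) \<Rightarrow> complex" where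
  "dirac_comb S w g = (\<Sum>\<^sub>\<infinity>x\<in>S. w x * g x)"

text \<open>
  The summability condition is needed because \<open>infsum\<close> is \<open>0\<close> for
  families that are not summable.
\<close>

definition is_dirac_comb_measure :: "'a::topological_space set \<Rightarrow> ('a \<Rightarrow> complex) \<Rightarrow> bool" where
  "is_dirac_comb_measure S w \<longleftrightarrow>
     (\<forall>g\<in>Kspace. (\<lambda>x. w x * g x) summable_on S) \<and> complex_measure (dirac_comb S w)"

definition fun_tilde :: "('a::group_add \<Rightarrow> complex) \<Rightarrow> 'a \<Rightarrow> complex" where
  "fun_tilde g x = cnj (g (- x))"

definition measure_tilde ::
    "(('a::group_add \<Rightarrow> complex) \<Rightarrow> complex) \<Rightarrow> ('a \<Rightarrow> complex) \<Rightarrow> complex" where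
  "measure_tilde \<mu> g = cnj (\<mu> (fun_tilde g))"

definition measure_conv ::
    "(('a::plus \<Rightarrow> complex) \<Rightarrow> complex) \<Rightarrow> (('a \<Rightarrow> complex) \<Rightarrow> complex) \<Rightarrow> ('a \<Rightarrow> complex) \<Rightarrow> complex" where
  "measure_conv \<mu> \<nu> g = \<mu> (\<lambda>x. \<nu> (\<lambda>y. g (x + y)))"

definition fun_conv ::
    "'a::group_add measure \<Rightarrow> ('a \<Rightarrow> complex) \<Rightarrow> ('a \<Rightarrow> complex) \<Rightarrow> 'a \<Rightarrow> complex" where
  "fun_conv \<theta> g h x = (LINT y|\<theta>. g y * h (x - y))"

definition fourier ::
    "'a::topological_ab_group_add measure \<Rightarrow> ('a \<Rightarrow> complex) \<Rightarrow> 'a dual_group \<Rightarrow> complex" where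
  "fourier \<theta> g k = (LINT x|\<theta>. cnj (char_app k x) * g x)"

text \<open>
  The defining property of the Fourier transform \<open>\<nu>\<close> of a positive definite measure
  \<open>\<gamma>\<close>: a positive measure on the dual group for which every \<open>norm (fourier \<theta> g (- k))\<^sup>2\<close>
  is integrable, with integral \<open>\<gamma> (g * g~)\<close>.
\<close>

definition has_fourier_transform ::
    "'a::topological_ab_group_add measure \<Rightarrow> (('a \<Rightarrow> complex) \<Rightarrow> complex) \<Rightarrow>
      'a dual_group measure \<Rightarrow> bool" where
  "has_fourier_transform \<theta> \<gamma> \<nu> \<longleftrightarrow>
     radon_measure \<nu> \<and>
     (\<forall>g\<in>Kspace. has_bochner_integral \<nu>
        (\<lambda>k. complex_of_real ((norm (fourier \<theta> g (- k)))\<^sup>2)) (\<gamma> (fun_conv \<theta> g (fun_tilde g))))"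


section \<open>Averaging, autocorrelation and point sets\<close>

definition averaging_sequence :: "(nat \<Rightarrow> 'a::topological_space set) \<Rightarrow> bool" where
  "averaging_sequence A \<longleftrightarrow>
     (\<forall>n. open (A n) \<and> compact (closure (A n))) \<and> A 0 \<noteq> {} \<and>
     (\<forall>n. closure (A n) \<subseteq> A (Suc n)) \<and> (\<Union>n. A n) = UNIV"

definition difference_set :: "'a::minus set \<Rightarrow> 'a set" where
  "difference_set S = {x - y |x y. x \<in> S \<and> y \<in> S}"

definition autocorr_coeff ::
    "'a::minus measure \<Rightarrow> (nat \<Rightarrow> 'a set) \<Rightarrow> 'a set \<Rightarrow> ('a \<Rightarrow> complex) \<Rightarrow> nat \<Rightarrow> 'a \<Rightarrow> complex" where
  "autocorr_coeff \<theta> A S w n z =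
     (\<Sum>\<^sub>\<infinity>(x, y)\<in>{(x, y). x \<in> S \<inter> A n \<and> y \<in> S \<inter> A n \<and> x - y = z}. w x * cnj (w y))
       / complex_of_real (measure \<theta> (A n))"

text \<open>
  \<open>\<gamma>\<close> is the autocorrelation of \<open>\<omega> = (\<Sum>x\<in>S. w x \<delta>\<^sub>x)\<close>: the vague limit of
  the normalised self-convolutions of the restrictions \<open>\<omega>|A\<^sub>n\<close>.
\<close>

definition is_autocorrelation ::
    "'a::{topological_space, group_add} measure \<Rightarrow> (nat \<Rightarrow> 'a set) \<Rightarrow> 'a set \<Rightarrow> ('a \<Rightarrow> complex) \<Rightarrow>
      (('a \<Rightarrow> complex) \<Rightarrow> complex) \<Rightarrow> bool" where
  "is_autocorrelation \<theta> A S w \<gamma> \<longleftrightarrow>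
     (\<forall>g\<in>Kspace.
        (\<lambda>n. measure_conv (dirac_comb (S \<inter> A n) w) (measure_tilde (dirac_comb (S \<inter> A n) w)) g
               / complex_of_real (measure \<theta> (A n)))
          \<longlonglongrightarrow> \<gamma> g)"

definition uniformly_discrete :: "'a::{topological_space, ab_group_add} set \<Rightarrow> bool" where
  "uniformly_discrete P \<longleftrightarrow>
     (\<exists>V. open V \<and> 0 \<in> V \<and> (\<forall>t\<in>P. ((+) t ` V) \<inter> P = {t}))"

definition relatively_dense :: "'a::{topological_space, ab_group_add} set \<Rightarrow> bool" where
  "relatively_dense P \<longleftrightarrow> (\<exists>K. compact K \<and> {p + k |p k. p \<in> P \<and> k \<in> K} = UNIV)"

end

theory Submission
  imports Defs
begin

text \<open>
  Replacing \<open>g\<close> by \<open>g - g(\<cdot> - t)\<close> multiplies \<open>|g^(-k)|\<^sup>2\<close> by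
  \<open>|1 - k(t)|\<^sup>2\<close>, while on the other side \<open>\<gamma>\<close> is paired with a second difference,
  which can be moved onto \<open>\<eta>\<close>.  By Krein's inequality
  \<open>|\<eta>(s + t) - \<eta>(s)|\<^sup>2 \<le> 2 \<eta>(0) Re (\<eta>(0) - \<eta>(t))\<close> and uniform discreteness of the
  support of \<open>\<eta>\<close>, the result is small, uniformly, for \<open>t\<close> in the relatively dense sets of
  hypothesis (4).  Hence on every compact set \<open>C\<close> where \<open>|g^(-k)|\<close> is bounded below, the
  function \<open>k \<mapsto> |1 - k(t)|\<^sup>2\<close> has small integral for relatively densely many \<open>t\<close>, so the
  transform of the restriction of \<open>\<nu>\<close> to \<open>C\<close> stays near \<open>\<nu>(C)\<close> there.  If \<open>C\<close> carries no
  atoms, Wiener's averaging argument allows this only for \<open>\<nu>(C) = 0\<close>.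
  Translation boundedness holds because multiplying \<open>g\<close> by a character translates its transform
  but leaves \<open>|g|\<close> unchanged.
\<close>

subsection \<open>Characters\<close>

text \<open>The almost periods \<open>t\<close> run off to infinity, so the points at which the
  second difference meets the support of \<open>\<eta>\<close> wander with \<open>t\<close>. A
  closed discrete difference set makes their number finite for each \<open>t\<close>; uniform
  discreteness of the support makes it bounded independently of \<open>t\<close>, and only then does
  one tolerance serve all \<open>t\<close>. The dual group need not be sigma-compact. Inner
  regularity therefore localises pure pointness to compact sets, which have finite mass and near
  each of whose points some transform stays away from zero. Wiener's limit of averages is replaced
  by means over finitely many points. Such means are multiplicative on characters with factors of
  modulus at most 1, so lengthening the list of points never spoils a bound already reached. Two
  compactness arguments, one for each variable of \<open>k - l\<close>, then give a single list for
  the whole compact set. The squared modulus of the transform is handled as an iterated integral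
  whose inner integral factors, so no product measure and no exchange of integrals occurs.\<close>

lemma continuous_on_char_app [continuous_intros]:
  "continuous_on X f \<Longrightarrow> continuous_on X (\<lambda>x. char_app k (f x))"
  using continuous_on_compose2[OF char_continuous[of k]] by blast

lemma eventually_char_near:
  assumes "compact K" "e > 0"
  shows "eventually (char_near K e k) (nhds k)"
  unfolding eventually_nhds_dual_group using assms by blast

lemma continuous_on_char_eval: "continuous_on UNIV (\<lambda>k. char_app k x)"
proof -
  have "((\<lambda>k. char_app k x) \<longlongrightarrow> char_app k x) (nhds k)" for k
  proof (rule tendstoI)
    fix e :: real assume "e > 0"
    then have "eventually (char_near {x} e k) (nhds k)" by (intro eventually_char_near) auto
    then show "eventually (\<lambda>l. dist (char_app l x) (char_app k x) < e) (nhds k)"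
      by (rule eventually_mono) (auto simp: char_near_def dist_commute)
  qed
  then show ?thesis
    unfolding continuous_on_def by (meson at_within_le_nhds tendsto_mono UNIV_I)
qed

lemma char_app_simps [simp]:
  "char_app 0 x = 1" "char_app (k + l) x = char_app k x * char_app l x"
  "char_app (- k) x = cnj (char_app k x)" "char_app (k - l) x = char_app k x * cnj (char_app l x)"
  by (simp_all add: zero_dual_group.rep_eq plus_dual_group.rep_eq uminus_dual_group.rep_eq
      minus_dual_group.rep_eq)

lemma char_app_mult_cnj [simp]:
  "char_app k x * cnj (char_app k x) = 1" "cnj (char_app k x) * char_app k x = 1"
  by (simp_all add: complex_norm_square[symmetric] mult.commute[of "cnj _"])

lemma char_app_zero [simp]: "char_app k 0 = 1"
proof -
  have "char_app k 0 \<noteq> 0" by (metis char_norm norm_zero zero_neq_one)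
  then show ?thesis using char_add[of k 0 0] by simp
qed

lemma char_app_uminus: "char_app k (- x) = cnj (char_app k x)"
proof -
  have "char_app k x * char_app k (- x) = 1" using char_add[of k x "- x"] by simp
  then have "cnj (char_app k x) * (char_app k x * char_app k (- x)) = cnj (char_app k x)" by simp
  then show ?thesis by (simp only: mult.assoc[symmetric] char_app_mult_cnj mult_1_left)
qed

lemma char_app_diff: "char_app k (x - y) = char_app k x * cnj (char_app k y)"
  using char_add[of k x "- y"] by (simp add: char_app_uminus)

text \<open>Integrated against a finite measure, this turns a small mean of
  \<open>|1 - k(t)|\<close> squared into a lower bound for the real part of its transform at
  \<open>t\<close>.\<close>

lemma norm_one_minus_char_app_sq: "(norm (1 - char_app k x))\<^sup>2 = 2 * (1 - Re (char_app k x))"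
proof -
  have "(Re (char_app k x))\<^sup>2 + (Im (char_app k x))\<^sup>2 = 1"
    by (metis cmod_power2 char_norm one_power2)
  then show ?thesis unfolding cmod_power2 by (simp add: power2_eq_square algebra_simps)
qed

subsection \<open>Topological groups\<close>

lemma open_translation_image:
  fixes U :: "'a::topological_ab_group_add set"
  assumes "open U" shows "open ((+) a ` U)"
proof -
  have eq: "(+) a ` U = (\<lambda>x. x - a) -` U"
    by (force intro: image_eqI[of _ _ "_ - a"])
  have "continuous_on UNIV (\<lambda>x. x - a)" by (intro continuous_intros)
  then show ?thesis unfolding eq using assms by (simp add: continuous_on_open_vimage)
qed

lemma compact_translation_image:
  fixes K :: "'a::topological_ab_group_add set"
  assumes "compact K" shows "compact ((+) a ` K)"
  using assms by (intro compact_continuous_image continuous_intros) auto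

lemma compact_diff_set:
  fixes K :: "'a::topological_ab_group_add set"
  assumes "compact K" "compact L" shows "compact {x - y |x y. x \<in> K \<and> y \<in> L}"
proof -
  have "{x - y |x y. x \<in> K \<and> y \<in> L} = (\<lambda>p. fst p - snd p) ` (K \<times> L)" by force
  moreover have "compact ((\<lambda>p. fst p - snd p) ` (K \<times> L))"
    using assms by (intro compact_continuous_image compact_Times continuous_intros)
  ultimately show ?thesis by simp
qed

lemma open_zero_diff_subset:
  fixes V :: "'a::topological_ab_group_add set"
  assumes "open V" "0 \<in> V"
  obtains U where "open U" "0 \<in> U" "\<And>x y. x \<in> U \<Longrightarrow> y \<in> U \<Longrightarrow> x - y \<in> V"
proof -
  have "continuous_on UNIV (\<lambda>p::'a \<times> 'a. fst p - snd p)" by (intro continuous_intros)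
  then have "open ((\<lambda>p::'a \<times> 'a. fst p - snd p) -` V)"
    using assms by (simp add: continuous_on_open_vimage)
  moreover have "(0, 0) \<in> (\<lambda>p::'a \<times> 'a. fst p - snd p) -` V" using assms by simp
  ultimately obtain A B where AB: "open A" "open B" "(0, 0) \<in> A \<times> B"
      "A \<times> B \<subseteq> (\<lambda>p. fst p - snd p) -` V"
    by (rule open_prod_elim)
  from AB(1-3) have "open (A \<inter> B)" "0 \<in> A \<inter> B" by auto
  moreover have "x - y \<in> V" if "x \<in> A \<inter> B" "y \<in> A \<inter> B" for x y
    using subsetD[OF AB(4), of "(x, y)"] that by simp
  ultimately show ?thesis by (rule that)
qed

lemma compact_finite_translates:
  fixes K :: "'a::topological_ab_group_add set"
  assumes "compact K" "open U" "0 \<in> U"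
  obtains F where "finite F" "K \<subseteq> (\<Union>a\<in>F. (+) a ` U)"
proof -
  have "K \<subseteq> (\<Union>a\<in>K. (+) a ` U)" using assms(3) by force
  then show ?thesis
    using compactE_image[OF assms(1), of K "\<lambda>a. (+) a ` U"] open_translation_image[OF assms(2)]
      that by metis
qed

text \<open>Pigeonhole: finitely many translates of a set \<open>U\<close> with \<open>U - U\<close>
  inside \<open>V\<close> cover \<open>L\<close>, and each translate of \<open>U\<close> holds at
  most one point of \<open>P\<close>. The number of translates does not depend on
  \<open>t\<close>.\<close>

lemma uniformly_discrete_card_bound:
  fixes P :: "'a::topological_ab_group_add set"
  assumes "uniformly_discrete P" "compact L"
  obtains N where "\<And>t. finite {z \<in> P. z - t \<in> L}" "\<And>t. card {z \<in> P. z - t \<in> L} \<le> N"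
proof -
  obtain V where V: "open V" "0 \<in> V" "\<And>t. t \<in> P \<Longrightarrow> ((+) t ` V) \<inter> P = {t}"
    using assms(1) unfolding uniformly_discrete_def by blast
  obtain U where U: "open U" "0 \<in> U" "\<And>x y. x \<in> U \<Longrightarrow> y \<in> U \<Longrightarrow> x - y \<in> V"
    using open_zero_diff_subset[OF V(1,2)] by blast
  obtain F where F: "finite F" "L \<subseteq> (\<Union>a\<in>F. (+) a ` U)"
    using compact_finite_translates[OF assms(2) U(1,2)] by blast
  have one: "p = q" if "p \<in> P" "q \<in> P" "p - t - a \<in> U" "q - t - a \<in> U" for p q t a
  proof -
    have "q - p \<in> V" using U(3)[OF that(4,3)] by (simp add: algebra_simps)
    then have "q \<in> (+) p ` V \<inter> P" using that(2) by (auto intro!: image_eqI[of _ _ "q - p"])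
    then show ?thesis using V(3)[OF that(1)] by auto
  qed
  have *: "finite {z \<in> P. z - t \<in> L} \<and> card {z \<in> P. z - t \<in> L} \<le> card F" for t
  proof -
    have "\<exists>a\<in>F. z - t - a \<in> U" if zt: "z - t \<in> L" for z
    proof -
      obtain a u where "a \<in> F" "u \<in> U" "z - t = a + u" using F(2) zt by auto
      then show ?thesis by (intro bexI[of _ a]) auto
    qed
    then obtain f where f: "\<And>z. z - t \<in> L \<Longrightarrow> f z \<in> F \<and> z - t - f z \<in> U" by metis
    have inj: "inj_on f {z \<in> P. z - t \<in> L}"
      by (rule inj_onI) (metis (mono_tags, lifting) f mem_Collect_eq one)
    have "f ` {z \<in> P. z - t \<in> L} \<subseteq> F" using f by auto
    then show ?thesis using inj F(1) by (meson card_inj_on_le finite_subset inj_on_finite)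
  qed
  show ?thesis by (rule that[of "card F"]) (use * in auto)
qed

lemma locally_compact_group_compact_nhd:
  assumes "locally_compact_space (euclidean :: 'a::topological_ab_group_add topology)"
  obtains U K :: "'a::topological_ab_group_add set" where "open U" "0 \<in> U" "U \<subseteq> K" "compact K"
proof -
  have "\<exists>U K::'a set. open U \<and> compact K \<and> 0 \<in> U \<and> U \<subseteq> K"
    using assms unfolding locally_compact_space_def by simp
  then show ?thesis using that by blast
qed

section \<open>Compactly supported test functions\<close>

lemma KspaceI:
  fixes g :: "'a::t2_space \<Rightarrow> complex"
  assumes "continuous_on UNIV g" "compact K" "\<And>x. x \<notin> K \<Longrightarrow> g x = 0"
  shows "g \<in> Kspace"
proof -
  have "supp g \<subseteq> K"
    unfolding supp_def using assms by (intro closure_minimal) (auto intro: compact_imp_closed)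
  then have "compact (supp g)"
    unfolding supp_def
    by (metis assms(2) closed_closure compact_Int_closed inf.absorb_iff2)
  then show ?thesis using assms(1) by (simp add: Kspace_def)
qed

lemma KspaceD:
  fixes g :: "'a::t2_space \<Rightarrow> complex"
  assumes "g \<in> Kspace"
  shows "continuous_on UNIV g" "compact (supp g)" "\<And>x. x \<notin> supp g \<Longrightarrow> g x = 0"
  using assms closure_subset[of "{x. g x \<noteq> 0}"] by (auto simp: Kspace_def supp_def)

lemma Kspace_bounded:
  fixes g :: "'a::t2_space \<Rightarrow> complex"
  assumes "g \<in> Kspace"
  obtains M where "M \<ge> 0" "\<And>x. norm (g x) \<le> M"
proof -
  have "compact (g ` supp g)"
    using KspaceD[OF assms] by (auto intro: compact_continuous_image continuous_on_subset)
  then obtain M where M: "\<And>x. x \<in> supp g \<Longrightarrow> norm (g x) \<le> M"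
    using compact_imp_bounded[of "g ` supp g"] unfolding bounded_iff by auto
  show ?thesis
  proof (rule that[of "max 0 M"])
    show "norm (g x) \<le> max 0 M" for x
      using M[of x] KspaceD(3)[OF assms, of x] by (cases "x \<in> supp g") auto
  qed simp
qed

text \<open>Locally compact Hausdorff spaces are completely regular: some \<open>f\<close> vanishes
  at \<open>0\<close> and equals 1 off a neighbourhood \<open>U\<close> contained in a compact set;
  \<open>1 - f\<close> is the bump.\<close>

lemma exists_bump:
  assumes "locally_compact_space (euclidean :: 'a::{topological_ab_group_add, t2_space} topology)"
  obtains b :: "'a::{topological_ab_group_add, t2_space} \<Rightarrow> real" where "continuous_on UNIV b" "\<And>x. b x \<ge> 0" "b 0 = 1"
    "(\<lambda>x. complex_of_real (b x)) \<in> Kspace"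
proof -
  obtain U K :: "'a set" where UK: "open U" "0 \<in> U" "U \<subseteq> K" "compact K"
    using locally_compact_group_compact_nhd[OF assms] by blast
  have "Hausdorff_space (euclidean :: 'a topology)"
    unfolding Hausdorff_space_def disjnt_def using hausdorff[where 'a='a] by simp
  then have "completely_regular_space (euclidean :: 'a topology)"
    using assms by (blast intro: locally_compact_regular_imp_completely_regular_space)
  moreover have "closedin euclidean (- U)" "0 \<in> topspace euclidean - (- U)" using UK by auto
  ultimately obtain f :: "'a \<Rightarrow> real" where
    f: "continuous_map euclidean (top_of_set {0..1}) f" "f 0 = 0" "f ` (- U) \<subseteq> {1}"
    unfolding completely_regular_space_def by metis
  have c: "continuous_on UNIV f" and r: "\<And>x. f x \<in> {0..1}"
    using f(1) by (auto simp: continuous_map_in_subtopology)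
  have "(\<lambda>x. complex_of_real (1 - f x)) \<in> Kspace"
    by (rule KspaceI[OF _ UK(4)]) (use c f(3) UK(3) in \<open>auto intro!: continuous_intros\<close>)
  then show ?thesis
    by (rule that[rotated 3]) (use c r f(2) in \<open>auto intro!: continuous_intros\<close>)
qed

subsection \<open>Haar measure\<close>

lemma radon_measureD:
  assumes "radon_measure \<nu>"
  shows "sets \<nu> = sets borel" "space \<nu> = UNIV" "\<And>K. compact K \<Longrightarrow> emeasure \<nu> K < \<infinity>"
    "\<And>B. B \<in> sets borel \<Longrightarrow> emeasure \<nu> B = (SUP K\<in>{K. compact K \<and> K \<subseteq> B}. emeasure \<nu> K)"
  using assms sets_eq_imp_space_eq[of \<nu> borel] unfolding radon_measure_def by auto

lemma radon_measure_inner_compact: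
  assumes "radon_measure \<nu>" "B \<in> sets borel" "emeasure \<nu> B \<noteq> 0"
  obtains K where "compact K" "K \<subseteq> B" "emeasure \<nu> K \<noteq> 0"
proof -
  have "0 < (SUP K\<in>{K. compact K \<and> K \<subseteq> B}. emeasure \<nu> K)"
    using assms radon_measureD(4)[OF assms(1,2)] zero_less_iff_neq_zero by metis
  then show ?thesis using that unfolding less_SUP_iff by auto
qed

lemma haar_measureD:
  assumes "haar_measure \<theta>"
  shows "radon_measure \<theta>" "emeasure \<theta> UNIV \<noteq> 0"
    "\<And>t B. B \<in> sets borel \<Longrightarrow> emeasure \<theta> ((+) t ` B) = emeasure \<theta> B"
  using assms unfolding haar_measure_def by auto

lemma borel_measurable_radon:
  assumes "radon_measure \<nu>" "continuous_on UNIV f"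
  shows "f \<in> borel_measurable \<nu>"
  using borel_measurable_continuous_onI[OF assms(2)] measurable_cong_sets[OF radon_measureD(1)[OF assms(1)] refl]
  by blast

lemma distr_haar_measure:
  fixes \<theta> :: "'a::topological_ab_group_add measure"
  assumes "haar_measure \<theta>"
  shows "distr \<theta> \<theta> (\<lambda>x. x + t) = \<theta>"
proof (rule measure_eqI)
  note s = radon_measureD(1,2)[OF haar_measureD(1)[OF assms]]
  fix B assume B: "B \<in> sets (distr \<theta> \<theta> (\<lambda>x. x + t))"
  have "(\<lambda>x. x + t) \<in> borel \<rightarrow>\<^sub>M borel"
    by (intro borel_measurable_continuous_onI continuous_intros)
  then have m: "(\<lambda>x. x + t) \<in> \<theta> \<rightarrow>\<^sub>M \<theta>"
    using measurable_cong_sets[OF s(1) s(1)] by blast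
  have eq: "(\<lambda>x. x + t) -` B = (+) (- t) ` B"
    by (force intro: image_eqI[of _ _ "_ + t"])
  show "emeasure (distr \<theta> \<theta> (\<lambda>x. x + t)) B = emeasure \<theta> B"
    using B m s haar_measureD(3)[OF assms, of B "- t"] by (simp add: emeasure_distr eq)
qed simp

lemma haar_integral_translate:
  fixes \<theta> :: "'a::topological_ab_group_add measure" and f :: "'a \<Rightarrow> complex"
  assumes "haar_measure \<theta>" "continuous_on UNIV f"
  shows "(LINT x|\<theta>. f (x + t)) = (LINT x|\<theta>. f x)"
proof -
  note s = radon_measureD(1,2)[OF haar_measureD(1)[OF assms(1)]]
  have "(\<lambda>x. x + t) \<in> borel \<rightarrow>\<^sub>M borel"
    by (intro borel_measurable_continuous_onI continuous_intros)
  then have m: "(\<lambda>x. x + t) \<in> \<theta> \<rightarrow>\<^sub>M \<theta>"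
    using measurable_cong_sets[OF s(1) s(1)] by blast
  show ?thesis
    using integral_distr[OF m borel_measurable_radon[OF haar_measureD(1)[OF assms(1)] assms(2)]]
    by (simp add: distr_haar_measure[OF assms(1)])
qed

lemma integrable_radon_compact_support:
  fixes f :: "'a::t2_space \<Rightarrow> 'b::{banach, second_countable_topology}"
  assumes \<nu>: "radon_measure \<nu>" and "continuous_on UNIV f" "compact K" "\<And>x. x \<notin> K \<Longrightarrow> f x = 0"
  shows "integrable \<nu> f"
proof -
  have "compact (f ` K)" using assms by (auto intro: compact_continuous_image continuous_on_subset)
  then obtain M where "\<And>x. x \<in> K \<Longrightarrow> norm (f x) \<le> M"
    using compact_imp_bounded[of "f ` K"] unfolding bounded_iff by auto
  moreover have "K \<in> sets \<nu>"
    using assms radon_measureD(1)[OF \<nu>] by (auto intro: borel_closed compact_imp_closed)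
  ultimately show ?thesis
    using assms(3,4) borel_measurable_radon[OF \<nu> assms(2)] radon_measureD(3)[OF \<nu> assms(3)]
    by (intro integrableI_bounded_set[of K _ _ M]) auto
qed

text \<open>If \<open>U\<close> were null, finitely many null translates would cover each compact
  set, and by inner regularity the whole group would be null.\<close>

lemma haar_measure_open_pos:
  fixes \<theta> :: "'a::{topological_ab_group_add, t2_space} measure"
  assumes "haar_measure \<theta>" "open U" "U \<noteq> {}"
  shows "emeasure \<theta> U \<noteq> 0"
proof
  assume 0: "emeasure \<theta> U = 0"
  note r = haar_measureD(1)[OF assms(1)]
  obtain u where u: "u \<in> U" using assms(3) by blast
  define W where "W = (+) (- u) ` U"
  have W: "open W" "0 \<in> W" "emeasure \<theta> W = 0"
    unfolding W_def
    subgoal using assms(2) by (rule open_translation_image)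
    subgoal using u by (intro image_eqI[of _ _ u]) auto
    subgoal using haar_measureD(3)[OF assms(1), of U "- u"] assms(2) 0 by auto
    done
  have "emeasure \<theta> (UNIV :: 'a set) \<noteq> 0" by (rule haar_measureD(2)[OF assms(1)])
  then obtain K where K: "compact K" "emeasure \<theta> K \<noteq> 0"
    using radon_measure_inner_compact[OF r, of UNIV] by auto
  obtain F where F: "finite F" "K \<subseteq> (\<Union>a\<in>F. (+) a ` W)"
    using compact_finite_translates[OF K(1) W(1,2)] by blast
  have sets: "(+) a ` W \<in> sets \<theta>" for a
    using open_translation_image[OF W(1)] radon_measureD(1)[OF r] by simp
  have "emeasure \<theta> K \<le> emeasure \<theta> (\<Union>a\<in>F. (+) a ` W)"
    using F sets by (intro emeasure_mono) auto
  also have "\<dots> \<le> (\<Sum>a\<in>F. emeasure \<theta> ((+) a ` W))"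
    using F sets by (intro emeasure_subadditive_finite) auto
  also have "\<dots> = 0" using haar_measureD(3)[OF assms(1), of W] W by simp
  finally show False using K(2) by simp
qed

text \<open>After removal of the atoms of \<open>B\<close>, any remaining positive mass would, by
  inner regularity, sit on a compact set without atoms.\<close>

lemma pure_pointI:
  fixes \<nu> :: "'a::t2_space measure"
  assumes \<nu>: "radon_measure \<nu>"
    and atomless: "\<And>C. compact C \<Longrightarrow> (\<And>x. x \<in> C \<Longrightarrow> emeasure \<nu> {x} = 0) \<Longrightarrow> emeasure \<nu> C = 0"
  shows "pure_point \<nu>"
  unfolding pure_point_def
proof
  note s = radon_measureD(1)[OF \<nu>]
  fix B assume B: "B \<in> sets \<nu>"
  have sing: "{x} \<in> sets \<nu>" for x by (simp add: s)
  have fin: "(\<Sum>x\<in>F. emeasure \<nu> {x}) = emeasure \<nu> F" if "finite F" for F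
    using that sing by (intro emeasure_eq_sum_singleton[symmetric]) auto
  define c where "c = (\<Sum>\<^sub>\<infinity>x\<in>B. emeasure \<nu> {x})"
  have c: "c = (SUP F\<in>{F. finite F \<and> F \<subseteq> B}. emeasure \<nu> F)"
    unfolding c_def by (subst nonneg_infsum_complete) (auto intro!: SUP_cong simp: fin)
  have le: "emeasure \<nu> F \<le> c" if "finite F" "F \<subseteq> B" for F
    unfolding c using that by (intro SUP_upper) auto
  have "c \<le> emeasure \<nu> B"
    unfolding c using B by (intro SUP_least emeasure_mono) auto
  moreover have "emeasure \<nu> B \<le> c"
  proof (cases "c = \<infinity>")
    case False
    then have ctop: "c < \<infinity>" by (simp add: less_top)
    \<comment> \<open>Finite total mass of the atoms makes their masses summable, so that
      \<open>N\<close> is countable and hence measurable. In the other case the upper bound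
      \<open>c\<close> is infinite and nothing is to be shown.\<close>
    define N where "N = {x \<in> B. measure \<nu> {x} \<noteq> 0}"
    have "(\<lambda>x. measure \<nu> {x}) summable_on B"
    proof (rule nonneg_bdd_above_summable_on)
      show "bdd_above (sum (\<lambda>x. measure \<nu> {x}) ` {F. F \<subseteq> B \<and> finite F})"
      proof (rule bdd_aboveI2)
        fix F assume F: "F \<in> {F. F \<subseteq> B \<and> finite F}"
        have "(\<Sum>x\<in>F. measure \<nu> {x}) = measure \<nu> F"
        proof -
          have "emeasure \<nu> {x} \<noteq> \<infinity>" for x
            using radon_measureD(3)[OF \<nu>, of "{x}"] by simp
          then show ?thesis
            using F sing by (intro measure_eq_sum_singleton[symmetric]) auto
        qed
        also have "\<dots> \<le> enn2real c"
          unfolding measure_def using le[of F] F ctop by (intro enn2real_mono) auto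
        finally show "(\<Sum>x\<in>F. measure \<nu> {x}) \<le> enn2real c" .
      qed
    qed auto
    then have "(\<lambda>x. norm (measure \<nu> {x})) summable_on B" by simp
    then have count: "countable N" unfolding N_def by (rule Infinite_Sum.abs_summable_countable)
    then have N: "N \<in> sets \<nu>" using sing by (rule sets.countable[rotated])
    have NB: "N \<subseteq> B" unfolding N_def by auto
    have "emeasure \<nu> N \<le> c"
    proof (cases "N = {}")
      case False
      \<comment> \<open>An increasing exhaustion of \<open>N\<close> by finite sets, each of mass at
        most \<open>c\<close>; continuity from below then bounds \<open>N\<close>.\<close>
      define A where "A n = from_nat_into N ` {..<n::nat}" for n
      have A: "A n \<subseteq> N" "finite (A n)" for n
        unfolding A_def using from_nat_into[OF False] by auto
      have "(\<Union>n. A n) = from_nat_into N ` (\<Union>n. {..<n})" unfolding A_def by blast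
      also have "(\<Union>n. {..<n::nat}) = UNIV" by auto
      finally have un: "(\<Union>n. A n) = N" using count False by (simp add: range_from_nat_into)
      have "(SUP n. emeasure \<nu> (A n)) = emeasure \<nu> (\<Union>n. A n)"
        using A(2) sing
        by (intro SUP_emeasure_incseq) (auto simp: incseq_def A_def intro: sets.countable countable_finite)
      moreover have "(SUP n. emeasure \<nu> (A n)) \<le> c"
        using A NB by (intro SUP_least le) auto
      ultimately show ?thesis using un by simp
    qed simp
    moreover have "emeasure \<nu> (B - N) = 0"
    proof (rule ccontr)
      assume "emeasure \<nu> (B - N) \<noteq> 0"
      then obtain C where C: "compact C" "C \<subseteq> B - N" "emeasure \<nu> C \<noteq> 0"
        using radon_measure_inner_compact[OF \<nu>, of "B - N"] B N s by auto
      have "emeasure \<nu> {x} = 0" if "x \<in> C" for x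
      proof -
        have "measure \<nu> {x} = 0" using C that unfolding N_def by auto
        then show ?thesis
          using radon_measureD(3)[OF \<nu>, of "{x}"] by (auto simp: measure_def enn2real_eq_0_iff)
      qed
      then show False using atomless[OF C(1)] C(3) by blast
    qed
    moreover have "emeasure \<nu> B \<le> emeasure \<nu> N + emeasure \<nu> (B - N)"
    proof -
      have "B = N \<union> (B - N)" using NB by auto
      then show ?thesis using emeasure_subadditive[of N \<nu> "B - N"] N B by auto
    qed
    ultimately show ?thesis by simp
  qed simp
  ultimately show "emeasure \<nu> B = (\<Sum>\<^sub>\<infinity>x\<in>B. emeasure \<nu> {x})" unfolding c_def by simp
qed

subsection \<open>Dirac combs and autocorrelation\<close>

text \<open>A closed discrete set has no limit point, hence finitely many points in a compact set.
  \<open>S\<close> inherits this because \<open>S - a\<close> lies in the difference set for each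
  \<open>a\<close> in \<open>S\<close>.\<close>

lemma locally_finite_of_difference_set:
  fixes S :: "'a::{topological_ab_group_add, t2_space} set"
  assumes "closed (difference_set S)" "discrete (difference_set S)" "compact K"
  shows "finite (K \<inter> difference_set S)" "finite (S \<inter> K)"
proof -
  have fin: "finite (L \<inter> difference_set S)" if L: "compact L" for L
  proof (rule finite_not_islimpt_in_compact[OF L])
    fix z
    show "\<not> z islimpt difference_set S"
      using assms(1,2) closed_limpt[of "difference_set S"]
      by (auto simp: discrete_def isolated_in_islimpt_iff)
  qed
  show "finite (K \<inter> difference_set S)" by (rule fin) fact
  show "finite (S \<inter> K)"
  proof (cases "S = {}")
    case False
    then obtain a where a: "a \<in> S" by blast
    have "(+) (- a) ` (S \<inter> K) \<subseteq> (+) (- a) ` K \<inter> difference_set S"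
      using a unfolding difference_set_def by force
    then have "finite ((+) (- a) ` (S \<inter> K))"
      using fin[OF compact_translation_image[OF assms(3), of "- a"]] finite_subset by blast
    then show ?thesis by (rule finite_imageD) (auto intro: inj_onI)
  qed simp
qed

lemma dirac_comb_eq_sum:
  assumes "finite D" "\<And>z. z \<in> S \<Longrightarrow> z \<notin> D \<Longrightarrow> w z * f z = 0" "\<And>z. z \<in> D \<Longrightarrow> z \<notin> S \<Longrightarrow> w z = 0"
  shows "dirac_comb S w f = (\<Sum>z\<in>D. w z * f z)"
proof -
  have "dirac_comb S w f = (\<Sum>\<^sub>\<infinity>z\<in>D. w z * f z)"
    unfolding dirac_comb_def by (rule infsum_cong_neutral) (use assms in auto)
  then show ?thesis using assms(1) by simp
qed

lemma autocorr_coeff_eq_sum: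
  fixes A :: "nat \<Rightarrow> 'a::ab_group_add set"
  assumes "finite (S \<inter> A n)"
  shows "autocorr_coeff \<theta> A S w n z =
    (\<Sum>p\<in>(S \<inter> A n) \<times> (S \<inter> A n). if fst p - snd p = z then w (fst p) * cnj (w (snd p)) else 0)
      / complex_of_real (measure \<theta> (A n))"
proof -
  let ?F = "S \<inter> A n"
  have "{(x, y). x \<in> ?F \<and> y \<in> ?F \<and> x - y = z} = {p \<in> ?F \<times> ?F. fst p - snd p = z}" by auto
  then show ?thesis
    unfolding autocorr_coeff_def using assms
    by (simp add: sum.inter_filter case_prod_beta flip: sum.inter_filter)
qed

text \<open>Extending the truncated weights by zero turns the sum over constrained pairs into a
  correlation on the whole group, the form in which Cauchy-Schwarz applies.\<close>

lemma autocorr_coeff_eq_correlation: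
  fixes A :: "nat \<Rightarrow> 'a::ab_group_add set"
    and w :: "'a \<Rightarrow> complex"
  assumes "finite (S \<inter> A n)"
  defines "v \<equiv> \<lambda>x. if x \<in> S \<inter> A n then w x else 0"
  shows "autocorr_coeff \<theta> A S w n z =
    (\<Sum>y\<in>S \<inter> A n. v (y + z) * cnj (v y)) / complex_of_real (measure \<theta> (A n))"
proof -
  let ?F = "S \<inter> A n"
  have "(\<Sum>p\<in>?F \<times> ?F. if fst p - snd p = z then w (fst p) * cnj (w (snd p)) else 0)
      = (\<Sum>y\<in>?F. \<Sum>x\<in>?F. if x = y + z then w x * cnj (w y) else 0)"
    by (subst sum.swap, subst sum.cartesian_product) (auto intro!: sum.cong simp: algebra_simps)
  also have "\<dots> = (\<Sum>y\<in>?F. v (y + z) * cnj (v y))"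
    using assms(1) by (intro sum.cong) (auto simp: v_def sum.delta')
  finally show ?thesis using autocorr_coeff_eq_sum[where S=S and A=A and n=n, OF assms(1)] by simp
qed

text \<open>Pairs \<open>(x, y)\<close> are grouped by \<open>x - y\<close>; only differences in
  \<open>D\<close> can contribute, since \<open>g\<close> vanishes at the others.\<close>

lemma measure_conv_tilde_dirac_comb:
  fixes S :: "'a::ab_group_add set" and A :: "nat \<Rightarrow> 'a set"
  assumes fin: "finite (S \<inter> A n)" and D: "finite D" "\<And>z. z \<in> difference_set S \<Longrightarrow> z \<notin> D \<Longrightarrow> g z = 0"
  shows "measure_conv (dirac_comb (S \<inter> A n) w) (measure_tilde (dirac_comb (S \<inter> A n) w)) g
      / complex_of_real (measure \<theta> (A n)) = (\<Sum>z\<in>D. autocorr_coeff \<theta> A S w n z * g z)"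
proof -
  let ?F = "S \<inter> A n"
  have comb: "dirac_comb ?F w f = (\<Sum>x\<in>?F. w x * f x)" for f
    using fin by (simp add: dirac_comb_def)
  have "measure_conv (dirac_comb ?F w) (measure_tilde (dirac_comb ?F w)) g
      = (\<Sum>p\<in>?F \<times> ?F. w (fst p) * cnj (w (snd p)) * g (fst p - snd p))"
    unfolding measure_conv_def measure_tilde_def fun_tilde_def comb
    by (simp add: sum_distrib_left sum.cartesian_product case_prod_beta mult.assoc)
  also have "\<dots> = (\<Sum>p\<in>?F \<times> ?F. \<Sum>z\<in>D. if z = fst p - snd p then w (fst p) * cnj (w (snd p)) * g z else 0)"
  proof (rule sum.cong)
    fix p assume p: "p \<in> ?F \<times> ?F"
    then have "fst p \<in> S" "snd p \<in> S" by auto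
    then have "fst p - snd p \<in> difference_set S" unfolding difference_set_def by blast
    with D show "w (fst p) * cnj (w (snd p)) * g (fst p - snd p) =
        (\<Sum>z\<in>D. if z = fst p - snd p then w (fst p) * cnj (w (snd p)) * g z else 0)"
      by (cases "fst p - snd p \<in> D") auto
  qed simp
  also have "\<dots> = (\<Sum>z\<in>D. (\<Sum>p\<in>?F \<times> ?F. if fst p - snd p = z then w (fst p) * cnj (w (snd p)) else 0) * g z)"
    by (subst sum.swap) (auto simp: sum_distrib_right intro!: sum.cong)
  finally show ?thesis
    unfolding autocorr_coeff_eq_sum[of S A n \<theta> w, OF fin] by (simp add: sum_divide_distrib[of _ D])
qed

text \<open>Cauchy-Schwarz for the first difference \<open>d\<close> of \<open>v\<close>:
  \<open>c (s + t) - c s\<close> pairs a translate of \<open>d\<close> with \<open>v\<close>, and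
  the squared norm of \<open>d\<close> over the whole group is
  \<open>2 * (Re (c 0) - Re (c t))\<close>.\<close>

lemma correlation_krein:
  fixes v :: "'a::ab_group_add \<Rightarrow> complex"
  assumes F: "finite F" and v: "\<And>x. x \<notin> F \<Longrightarrow> v x = 0"
  defines "c \<equiv> \<lambda>z. \<Sum>y\<in>F. v (y + z) * cnj (v y)"
  shows "(norm (c (s + t) - c s))\<^sup>2 \<le> 2 * Re (c 0) * (Re (c 0) - Re (c t))"
proof -
  define d where "d u = v (u + t) - v u" for u
  \<comment> \<open>A finite set containing the supports of \<open>v\<close>, of its translate by
    \<open>t\<close>, and hence of \<open>d\<close>, on which all sums can be compared.\<close>
  define Z where "Z = F \<union> (\<lambda>x. x - t) ` F"
  have Z: "finite Z" using F by (simp add: Z_def)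
  have d0: "d u = 0" if "u \<notin> Z" for u
  proof -
    have "u + t \<notin> F" using that by (force simp: Z_def intro: image_eqI[of _ _ "u + t"])
    then show ?thesis using that v by (auto simp: d_def Z_def)
  qed
  have c0: "Re (c 0) = (\<Sum>y\<in>F. (norm (v y))\<^sup>2)"
    unfolding c_def by (simp add: complex_norm_square[symmetric] Re_sum)
  have "c (s + t) - c s = (\<Sum>y\<in>F. d (y + s) * cnj (v y))"
    by (simp add: c_def d_def algebra_simps sum_subtractf)
  then have "norm (c (s + t) - c s) \<le> (\<Sum>y\<in>F. norm (d (y + s)) * norm (v y))"
    by (simp add: norm_mult order_trans[OF norm_sum])
  then have "(norm (c (s + t) - c s))\<^sup>2 \<le> (\<Sum>y\<in>F. norm (d (y + s)) * norm (v y))\<^sup>2"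
    by (intro power_mono) auto
  also have "\<dots> \<le> (\<Sum>y\<in>F. (norm (d (y + s)))\<^sup>2) * (\<Sum>y\<in>F. (norm (v y))\<^sup>2)"
    by (rule Cauchy_Schwarz_ineq_sum)
  also have "(\<Sum>y\<in>F. (norm (d (y + s)))\<^sup>2) \<le> 2 * (Re (c 0) - Re (c t))"
  proof -
    have "(\<Sum>y\<in>F. (norm (d (y + s)))\<^sup>2) = (\<Sum>u\<in>(\<lambda>y. y + s) ` F. (norm (d u))\<^sup>2)"
      by (subst sum.reindex) (auto intro: inj_onI)
    also have "\<dots> \<le> (\<Sum>u\<in>(\<lambda>y. y + s) ` F \<union> Z. (norm (d u))\<^sup>2)"
      using F Z by (intro sum_mono2) auto
    also have "\<dots> = (\<Sum>u\<in>Z. (norm (d u))\<^sup>2)"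
      using F Z d0 by (intro sum.mono_neutral_right) auto
    also have "\<dots> = (\<Sum>u\<in>Z. (norm (v (u + t)))\<^sup>2 + (norm (v u))\<^sup>2 - 2 * Re (v (u + t) * cnj (v u)))"
      unfolding d_def cmod_power2 by (intro sum.cong) (auto simp: power2_eq_square algebra_simps)
    also have "\<dots> = (\<Sum>u\<in>Z. (norm (v (u + t)))\<^sup>2) + (\<Sum>u\<in>Z. (norm (v u))\<^sup>2)
        - 2 * Re (\<Sum>u\<in>Z. v (u + t) * cnj (v u))"
      by (simp add: sum.distrib sum_subtractf sum_distrib_left)
    also have "(\<Sum>u\<in>Z. v (u + t) * cnj (v u)) = c t"
      unfolding c_def using Z v by (intro sum.mono_neutral_right) (auto simp: Z_def)
    also have "(\<Sum>u\<in>Z. (norm (v u))\<^sup>2) = Re (c 0)"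
      unfolding c0 using Z v by (intro sum.mono_neutral_right) (auto simp: Z_def)
    also have "(\<Sum>u\<in>Z. (norm (v (u + t)))\<^sup>2) = (\<Sum>u\<in>(\<lambda>x. x - t) ` F. (norm (v (u + t)))\<^sup>2)"
    proof (intro sum.mono_neutral_right ballI)
      fix u assume "u \<in> Z - (\<lambda>x. x - t) ` F"
      then have "u + t \<notin> F" by (force intro: image_eqI[of _ _ "u + t"])
      then show "(norm (v (u + t)))\<^sup>2 = 0" using v by simp
    qed (use Z in \<open>auto simp: Z_def\<close>)
    also have "\<dots> = Re (c 0)" unfolding c0 by (subst sum.reindex) (auto intro: inj_onI)
    finally show ?thesis by simp
  qed
  finally show ?thesis
    unfolding c0[symmetric] by (simp add: mult_right_mono sum_nonneg c0 algebra_simps)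
qed

text \<open>Krein's inequality passes from the finite correlations to their limit, so that \<open>\<eta>\<close>
  inherits almost periods from its behaviour at \<open>0\<close>.\<close>

lemma autocorr_limit_krein:
  fixes S :: "'a::ab_group_add set" and A :: "nat \<Rightarrow> 'a set"
  assumes fin: "\<And>n. finite (S \<inter> A n)"
    and lim: "\<And>z. (\<lambda>n. autocorr_coeff \<theta> A S w n z) \<longlonglongrightarrow> \<eta> z"
  shows "(norm (\<eta> (s + t) - \<eta> s))\<^sup>2 \<le> 2 * Re (\<eta> 0) * (Re (\<eta> 0) - Re (\<eta> t))"
proof (rule LIMSEQ_le)
  let ?e = "autocorr_coeff \<theta> A S w"
  show "(\<lambda>n. (norm (?e n (s + t) - ?e n s))\<^sup>2) \<longlonglongrightarrow> (norm (\<eta> (s + t) - \<eta> s))\<^sup>2"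
    by (intro tendsto_intros lim)
  show "(\<lambda>n. 2 * Re (?e n 0) * (Re (?e n 0) - Re (?e n t))) \<longlonglongrightarrow>
      2 * Re (\<eta> 0) * (Re (\<eta> 0) - Re (\<eta> t))"
    by (intro tendsto_intros lim)
  have "(norm (?e n (s + t) - ?e n s))\<^sup>2 \<le> 2 * Re (?e n 0) * (Re (?e n 0) - Re (?e n t))" for n
  proof -
    define r where "r = measure \<theta> (A n)"
    define v where "v = (\<lambda>x. if x \<in> S \<inter> A n then w x else 0)"
    define c where "c = (\<lambda>z. \<Sum>y\<in>S \<inter> A n. v (y + z) * cnj (v y))"
    have e: "?e n z = c z / complex_of_real r" for z
      unfolding c_def v_def r_def by (rule autocorr_coeff_eq_correlation[OF fin])
    have "(norm (c (s + t) - c s))\<^sup>2 \<le> 2 * Re (c 0) * (Re (c 0) - Re (c t))"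
      unfolding c_def by (rule correlation_krein[OF fin]) (auto simp: v_def)
    \<comment> \<open>This covers \<open>r = 0\<close> too: both quotients are then 0.\<close>
    then have "(norm (c (s + t) - c s))\<^sup>2 / r\<^sup>2 \<le> 2 * Re (c 0) * (Re (c 0) - Re (c t)) / r\<^sup>2"
      by (rule divide_right_mono) simp
    moreover have "norm (?e n (s + t) - ?e n s) = norm (c (s + t) - c s) / \<bar>r\<bar>"
      unfolding e by (simp add: norm_divide flip: diff_divide_distrib)
    moreover have "2 * Re (?e n 0) * (Re (?e n 0) - Re (?e n t))
        = 2 * Re (c 0) * (Re (c 0) - Re (c t)) / r\<^sup>2"
      unfolding e by (simp add: power2_eq_square flip: diff_divide_distrib)
    ultimately show ?thesis by (simp add: power_divide)
  qed
  then show "\<exists>N. \<forall>n\<ge>N. (norm (?e n (s + t) - ?e n s))\<^sup>2 \<le>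
      2 * Re (?e n 0) * (Re (?e n 0) - Re (?e n t))" by blast
qed

section \<open>Correlations of test functions and their second differences\<close>

lemma fun_conv_tilde:
  fixes g :: "'a::ab_group_add \<Rightarrow> complex"
  shows "fun_conv \<theta> g (fun_tilde g) z = (LINT y|\<theta>. g y * cnj (g (y - z)))"
  unfolding fun_conv_def fun_tilde_def by simp

lemma fun_conv_tilde_eq_0:
  fixes g :: "'a::ab_group_add \<Rightarrow> complex"
  assumes "\<And>x. x \<notin> K \<Longrightarrow> g x = 0" "z \<notin> {x - y |x y. x \<in> K \<and> y \<in> K}"
  shows "fun_conv \<theta> g (fun_tilde g) z = 0"
proof -
  have "(\<lambda>y. g y * cnj (g (y - z))) = (\<lambda>y. 0)"
  proof (rule ext, rule ccontr)
    fix y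
    assume "g y * cnj (g (y - z)) \<noteq> 0"
    then have "y \<in> K" "y - z \<in> K" using assms(1) by fastforce+
    then have "y - (y - z) \<in> {x - y |x y. x \<in> K \<and> y \<in> K}" by blast
    then show False using assms(2) by simp
  qed
  then show ?thesis unfolding fun_conv_tilde by (simp only:) simp
qed

lemma integrable_Kspace:
  fixes g h :: "'a::{topological_ab_group_add, t2_space} \<Rightarrow> complex"
  assumes "haar_measure \<theta>" "g \<in> Kspace" "continuous_on UNIV h"
  shows "integrable \<theta> (\<lambda>x. h x * g x :: complex)" "integrable \<theta> (\<lambda>x. g x * h x)" "integrable \<theta> g"
    "integrable \<theta> (\<lambda>x. norm (g x))"
  using KspaceD[OF assms(2)] assms(3)
  by (auto intro!: integrable_radon_compact_support[OF haar_measureD(1)[OF assms(1)], of _ "supp g"] continuous_intros)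

text \<open>The bound sees only the modulus of \<open>g\<close>, so one constant serves all
  modulations of \<open>g\<close> by characters. Nothing else about \<open>g'\<close> is required: a
  nonintegrable integrand has integral 0.\<close>

lemma norm_fun_conv_tilde_le:
  fixes g g' :: "'a::{topological_ab_group_add, t2_space} \<Rightarrow> complex"
  assumes "haar_measure \<theta>" "g \<in> Kspace" "\<And>x. norm (g' x) = norm (g x)" "\<And>x. norm (g x) \<le> M"
  shows "norm (fun_conv \<theta> g' (fun_tilde g') z) \<le> M * (LINT y|\<theta>. norm (g y))"
proof -
  have M: "M \<ge> 0" using assms(4)[of 0] norm_ge_zero order_trans by blast
  have "norm (fun_conv \<theta> g' (fun_tilde g') z) \<le> (LINT y|\<theta>. norm (g' y * cnj (g' (y - z))))"
    unfolding fun_conv_tilde by (rule integral_norm_bound)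
  also have "\<dots> \<le> (LINT y|\<theta>. M * norm (g y))"
  proof (rule integral_mono_AE')
    show "integrable \<theta> (\<lambda>y. M * norm (g y))"
      using integrable_Kspace(4)[OF assms(1,2) continuous_on_const] by simp
    show "AE y in \<theta>. norm (g' y * cnj (g' (y - z))) \<le> M * norm (g y)"
      using assms(3,4) M by (intro AE_I2) (auto simp: norm_mult mult.commute[of M] intro!: mult_left_mono)
  qed (use M in auto)
  finally show ?thesis by simp
qed

text \<open>The product of the two differences has four terms, each a correlation of
  \<open>g\<close> after a shift of the integration variable; two of them are
  \<open>h z\<close>.\<close>

lemma fun_conv_tilde_translate_diff:
  fixes g :: "'a::{topological_ab_group_add, t2_space} \<Rightarrow> complex" and t :: 'a
  assumes \<theta>: "haar_measure \<theta>" and g: "g \<in> Kspace"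
  defines "h \<equiv> fun_conv \<theta> g (fun_tilde g)"
  defines "g' \<equiv> \<lambda>x. g x - g (x - t)"
  shows "fun_conv \<theta> g' (fun_tilde g') z = 2 * h z - h (z + t) - h (z - t)"
proof -
  have cont: "continuous_on UNIV (\<lambda>x. g (x - a))" for a
    by (rule continuous_on_compose2[OF KspaceD(1)[OF g]]) (auto intro!: continuous_intros)
  have gt: "(\<lambda>x. g (x - a)) \<in> Kspace" for a
  proof (rule KspaceI[OF cont, of "(+) a ` supp g"])
    show "compact ((+) a ` supp g)" using KspaceD(2)[OF g] by (rule compact_translation_image)
    show "g (x - a) = 0" if "x \<notin> (+) a ` supp g" for x
      using that by (intro KspaceD(3)[OF g]) (force intro: image_eqI[of _ _ "x - a"])
  qed
  have c0: "continuous_on UNIV g" using KspaceD(1)[OF g] .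
  note int = integrable_Kspace(2)[OF \<theta> gt]
  have shift: "(LINT y|\<theta>. f (y - t)) = (LINT y|\<theta>. f y)" if "continuous_on UNIV f" for f :: "'a \<Rightarrow> complex"
    using haar_integral_translate[OF \<theta> that, of "- t"] by simp
  have "fun_conv \<theta> g' (fun_tilde g') z
      = (LINT y|\<theta>. (g y * cnj (g (y - z)) - g y * cnj (g (y - (z + t))))
          - (g (y - t) * cnj (g (y - z)) - g (y - t) * cnj (g (y - (z + t)))))"
    unfolding fun_conv_tilde g'_def by (intro Bochner_Integration.integral_cong) (auto simp: algebra_simps)
  also have "\<dots> = (LINT y|\<theta>. g y * cnj (g (y - z))) - (LINT y|\<theta>. g y * cnj (g (y - (z + t))))
      - ((LINT y|\<theta>. g (y - t) * cnj (g (y - z))) - (LINT y|\<theta>. g (y - t) * cnj (g (y - (z + t)))))"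
    using int[of "\<lambda>y. cnj (g (y - z))" 0] int[of "\<lambda>y. cnj (g (y - z))" t] int[of "\<lambda>y. cnj (g (y - (z + t)))" 0]
      int[of "\<lambda>y. cnj (g (y - (z + t)))" t] cont
    by (simp add: continuous_on_cnj)
  also have "(LINT y|\<theta>. g (y - t) * cnj (g (y - z))) = h (z - t)"
  proof -
    have "(LINT y|\<theta>. g (y - t) * cnj (g (y - t - (z - t)))) = (LINT y|\<theta>. g y * cnj (g (y - (z - t))))"
      by (rule shift) (intro continuous_intros cont c0)
    then show ?thesis unfolding h_def fun_conv_tilde by simp
  qed
  also have "(LINT y|\<theta>. g (y - t) * cnj (g (y - (z + t)))) = h z"
  proof -
    have "(LINT y|\<theta>. g (y - t) * cnj (g (y - t - z))) = (LINT y|\<theta>. g y * cnj (g (y - z)))"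
      by (rule shift) (intro continuous_intros cont c0)
    moreover have "y - t - z = y - (z + t)" for y by (simp add: algebra_simps)
    ultimately show ?thesis unfolding h_def fun_conv_tilde by simp
  qed
  finally show ?thesis unfolding h_def fun_conv_tilde by simp
qed

lemma Kspace_translate_diff:
  fixes g :: "'a::{topological_ab_group_add, t2_space} \<Rightarrow> complex"
  assumes g: "g \<in> Kspace"
  shows "(\<lambda>x. g x - g (x - t)) \<in> Kspace"
proof (rule KspaceI[of _ "supp g \<union> (+) t ` supp g"])
  show "continuous_on UNIV (\<lambda>x. g x - g (x - t))"
    by (intro continuous_intros KspaceD(1)[OF g] continuous_on_compose2[OF KspaceD(1)[OF g]]) auto
  show "compact (supp g \<union> (+) t ` supp g)"
    using KspaceD(2)[OF g] by (intro compact_Un compact_translation_image)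
  fix x assume x: "x \<notin> supp g \<union> (+) t ` supp g"
  then have "x - t \<notin> supp g" by (force intro: image_eqI[of _ _ "x - t"])
  then show "g x - g (x - t) = 0" using x KspaceD(3)[OF g] by simp
qed

lemma fourier_translate_diff:
  fixes g :: "'a::{topological_ab_group_add, t2_space} \<Rightarrow> complex"
  assumes \<theta>: "haar_measure \<theta>" and g: "g \<in> Kspace"
  shows "fourier \<theta> (\<lambda>x. g x - g (x - t)) k = (1 - cnj (char_app k t)) * fourier \<theta> g k"
proof -
  have c0: "continuous_on UNIV g" using KspaceD(1)[OF g] .
  have cc: "continuous_on UNIV (\<lambda>x. cnj (char_app k x))" by (intro continuous_intros)
  have i1: "integrable \<theta> (\<lambda>x. cnj (char_app k x) * g x)"
    by (rule integrable_Kspace(1)[OF \<theta> g cc])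
  have "integrable \<theta> (\<lambda>x. cnj (char_app k x) * (g x - g (x - t)))"
    by (rule integrable_Kspace(1)[OF \<theta> Kspace_translate_diff[OF g] cc])
  then have "integrable \<theta> (\<lambda>x. cnj (char_app k x) * g x - cnj (char_app k x) * (g x - g (x - t)))"
    using i1 by (rule Bochner_Integration.integrable_diff[rotated])
  then have i2: "integrable \<theta> (\<lambda>x. cnj (char_app k x) * g (x - t))" by (simp add: algebra_simps)
  have "(LINT x|\<theta>. cnj (char_app k x) * g (x - t))
      = (LINT x|\<theta>. (\<lambda>x. cnj (char_app k t) * (cnj (char_app k x) * g x)) (x - t))"
  proof (rule Bochner_Integration.integral_cong[OF refl])
    fix x
    have "cnj (char_app k t) * char_app k t = 1" by simp
    then have "c * g (x - t) = cnj (char_app k t) * (c * char_app k t * g (x - t))" for c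
      by algebra
    then show "cnj (char_app k x) * g (x - t)
        = (\<lambda>x. cnj (char_app k t) * (cnj (char_app k x) * g x)) (x - t)"
      by (simp add: char_app_diff)
  qed
  also have "\<dots> = (LINT x|\<theta>. cnj (char_app k t) * (cnj (char_app k x) * g x))"
    using haar_integral_translate[OF \<theta>, of "\<lambda>x. cnj (char_app k t) * (cnj (char_app k x) * g x)" "- t"] c0 cc
    by (simp add: continuous_on_mult)
  also have "\<dots> = cnj (char_app k t) * (LINT x|\<theta>. cnj (char_app k x) * g x)" by simp
  finally show ?thesis
    unfolding fourier_def using i1 i2 by (simp add: right_diff_distrib left_diff_distrib)
qed

text \<open>Summation by parts: the second difference moves from \<open>h\<close> to
  \<open>\<eta>\<close>, where it is at most \<open>\<delta>\<close>. The sum that remains lives on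
  at most \<open>3 * N\<close> points, \<open>N\<close> for each of the shifts \<open>0\<close>,
  \<open>t\<close> and \<open>- t\<close>.\<close>

lemma dirac_comb_second_difference_le:
  fixes \<eta> h :: "'a::{topological_ab_group_add, t2_space} \<Rightarrow> complex"
  assumes \<eta>: "\<And>z. z \<notin> \<Delta> \<Longrightarrow> \<eta> z = 0"
    and h: "\<And>z. z \<notin> L \<Longrightarrow> h z = 0" "\<And>z. norm (h z) \<le> M"
    and fin: "\<And>t. finite {z \<in> {z. \<eta> z \<noteq> 0}. z - t \<in> L}"
    and card: "\<And>t. card {z \<in> {z. \<eta> z \<noteq> 0}. z - t \<in> L} \<le> N"
    and d: "\<And>z. norm (2 * \<eta> z - \<eta> (z - t) - \<eta> (z + t)) \<le> \<delta>"
  shows "norm (dirac_comb \<Delta> \<eta> (\<lambda>z. 2 * h z - h (z + t) - h (z - t))) \<le> 3 * real N * (\<delta> * M)"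
proof -
  \<comment> \<open>The points of the support of \<open>\<eta>\<close> at which
    \<open>h (z - s)\<close> can be nonzero.\<close>
  define D where "D s = {z \<in> {z. \<eta> z \<noteq> 0}. z - s \<in> L}" for s
  have D: "finite (D s)" "card (D s) \<le> N" for s using fin card unfolding D_def by auto
  define Z where "Z = D 0 \<union> D (- t) \<union> D t"
  \<comment> \<open>The same points after the substitution \<open>u = z - s\<close>: outside
    \<open>E\<close> the product \<open>\<eta> (u + s) * h u\<close> vanishes for all three shifts
    \<open>s\<close>.\<close>
  define E where "E = D 0 \<union> (\<lambda>z. z + t) ` D (- t) \<union> (\<lambda>z. z - t) ` D t"
  have Z: "finite Z" and E: "finite E" using D by (auto simp: Z_def E_def)
  have \<delta>M: "\<delta> \<ge> 0" "M \<ge> 0" using d[of 0] h(2)[of 0] norm_ge_zero order_trans by blast+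
  have shift: "(\<Sum>z\<in>Z. \<eta> z * h (z - s)) = (\<Sum>u\<in>E. \<eta> (u + s) * h u)"
    if s: "s \<in> {0, t, - t}" for s
  proof -
    have 1: "D s \<subseteq> Z" using s by (auto simp: Z_def)
    have 2: "(\<lambda>z. z - s) ` D s \<subseteq> E" using s by (auto simp: E_def)
    have "(\<Sum>z\<in>Z. \<eta> z * h (z - s)) = (\<Sum>z\<in>D s. \<eta> z * h (z - s))"
      using Z 1 h(1) by (intro sum.mono_neutral_right) (auto simp: D_def)
    also have "\<dots> = (\<Sum>u\<in>(\<lambda>z. z - s) ` D s. \<eta> (u + s) * h u)"
      by (subst sum.reindex) (auto intro: inj_onI)
    also have "\<dots> = (\<Sum>u\<in>E. \<eta> (u + s) * h u)"
    proof (intro sum.mono_neutral_left ballI)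
      fix u assume u: "u \<in> E - (\<lambda>z. z - s) ` D s"
      then have "u + s \<notin> D s" by (force intro: image_eqI[of _ _ "u + s"])
      then show "\<eta> (u + s) * h u = 0" using h(1)[of u] by (auto simp: D_def)
    qed (use E 2 in auto)
    finally show ?thesis .
  qed
  have "dirac_comb \<Delta> \<eta> (\<lambda>z. 2 * h z - h (z + t) - h (z - t))
      = (\<Sum>z\<in>Z. \<eta> z * (2 * h z - h (z + t) - h (z - t)))"
  proof (rule dirac_comb_eq_sum[OF Z])
    fix z assume "z \<notin> Z"
    then have "\<eta> z = 0 \<or> (z \<notin> L \<and> z + t \<notin> L \<and> z - t \<notin> L)" by (auto simp: Z_def D_def)
    then show "\<eta> z * (2 * h z - h (z + t) - h (z - t)) = 0" using h(1) by auto
  qed (use \<eta> in auto)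
  also have "\<dots> = 2 * (\<Sum>z\<in>Z. \<eta> z * h z) - (\<Sum>z\<in>Z. \<eta> z * h (z + t)) - (\<Sum>z\<in>Z. \<eta> z * h (z - t))"
    by (simp add: algebra_simps sum_subtractf sum_distrib_left sum.distrib)
  also have "\<dots> = 2 * (\<Sum>u\<in>E. \<eta> u * h u) - (\<Sum>u\<in>E. \<eta> (u - t) * h u) - (\<Sum>u\<in>E. \<eta> (u + t) * h u)"
    using shift[of 0] shift[of t] shift[of "- t"] by simp
  also have "\<dots> = (\<Sum>u\<in>E. (2 * \<eta> u - \<eta> (u - t) - \<eta> (u + t)) * h u)"
    by (simp add: algebra_simps sum_subtractf sum_distrib_left sum.distrib)
  also have "norm \<dots> \<le> (\<Sum>u\<in>E. \<delta> * M)"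
    using d h(2) \<delta>M by (intro sum_norm_le) (auto simp: norm_mult intro!: mult_mono)
  also have "\<dots> = real (card E) * (\<delta> * M)" by simp
  also have "\<dots> \<le> 3 * real N * (\<delta> * M)"
  proof (rule mult_right_mono)
    have "card E \<le> card (D 0) + card ((\<lambda>z. z + t) ` D (- t)) + card ((\<lambda>z. z - t) ` D t)"
      unfolding E_def by (meson add_right_mono card_Un_le order_trans)
    also have "\<dots> \<le> N + N + N"
      using D card_image_le by (meson add_mono order_trans)
    finally show "real (card E) \<le> 3 * real N" by linarith
  qed (use \<delta>M in auto)
  finally show ?thesis .
qed

subsection \<open>Fourier transforms of compactly supported functions\<close>

text \<open>Nearness is asked only on the compact support of \<open>g\<close>, which is exactly what
  a neighbourhood in the dual group provides.\<close>

lemma norm_fourier_diff_le: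
  fixes g :: "'a::{topological_ab_group_add, t2_space} \<Rightarrow> complex"
  assumes \<theta>: "haar_measure \<theta>" and g: "g \<in> Kspace" and near: "char_near (supp g) e k l"
  shows "norm (fourier \<theta> g k - fourier \<theta> g l) \<le> e * (LINT x|\<theta>. norm (g x))"
proof -
  have int: "integrable \<theta> (\<lambda>x. cnj (char_app m x) * g x)" for m
    by (rule integrable_Kspace(1)[OF \<theta> g]) (intro continuous_intros)
  have "fourier \<theta> g k - fourier \<theta> g l = (LINT x|\<theta>. cnj (char_app k x - char_app l x) * g x)"
    unfolding fourier_def using int by (simp add: left_diff_distrib)
  also have "norm \<dots> \<le> (LINT x|\<theta>. norm (cnj (char_app k x - char_app l x) * g x))"
    by (rule integral_norm_bound)
  also have "\<dots> \<le> (LINT x|\<theta>. e * norm (g x))"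
  proof (rule integral_mono)
    show "integrable \<theta> (\<lambda>x. norm (cnj (char_app k x - char_app l x) * g x))"
      using Bochner_Integration.integrable_diff[OF int[of k] int[of l]] by (simp add: left_diff_distrib)
    show "integrable \<theta> (\<lambda>x. e * norm (g x))"
      using integrable_Kspace(4)[OF \<theta> g continuous_on_const] by simp
    fix x
    have le: "norm (char_app k x - char_app l x) \<le> e" if "x \<in> supp g"
      using near that unfolding char_near_def dist_norm by (simp add: less_imp_le)
    show "norm (cnj (char_app k x - char_app l x) * g x) \<le> e * norm (g x)"
    proof (cases "x \<in> supp g")
      case True
      then show ?thesis using le unfolding norm_mult complex_mod_cnj by (intro mult_right_mono) auto
    next
      case False
      then show ?thesis using KspaceD(3)[OF g] by simp
    qed
  qed
  finally show ?thesis by simp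
qed

text \<open>A bump modulated by the conjugate of \<open>k\<close> has, at \<open>- k\<close>, a
  transform equal to the integral \<open>I\<close> of the bump. \<open>I\<close> is positive because
  the bump exceeds 1/2 on a nonempty open set.\<close>

lemma exists_fourier_bounded_below:
  fixes \<theta> :: "'a::{topological_ab_group_add, t2_space} measure"
  assumes lc: "locally_compact_space (euclidean :: 'a topology)" and \<theta>: "haar_measure \<theta>"
  obtains g U c where "g \<in> Kspace" "open U" "k \<in> U" "c > 0"
    "\<And>l. l \<in> U \<Longrightarrow> norm (fourier \<theta> g (- l)) \<ge> c"
proof -
  obtain b :: "'a \<Rightarrow> real" where b: "continuous_on UNIV b" "\<And>x. b x \<ge> 0" "b 0 = 1"
    "(\<lambda>x. complex_of_real (b x)) \<in> Kspace"
    using exists_bump[OF lc] by blast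
  define g where "g x = cnj (char_app k x) * complex_of_real (b x)" for x
  have g: "g \<in> Kspace"
    unfolding g_def
    by (rule KspaceI[OF _ KspaceD(2)[OF b(4)]])
      (use KspaceD(3)[OF b(4)] b(1) in \<open>auto intro!: continuous_intros\<close>)
  have int: "integrable \<theta> b"
    using integrable_Kspace(4)[OF \<theta> b(4) continuous_on_const] b(2) by simp
  define I where "I = (LINT x|\<theta>. b x)"
  have "I \<noteq> 0"
  proof
    assume "I = 0"
    then have "AE x in \<theta>. b x = 0"
      using integral_nonneg_eq_0_iff_AE[OF int] b(2) unfolding I_def by simp
    moreover have op: "open (b -` {1/2<..})"
      using b(1) by (simp add: continuous_on_open_vimage)
    ultimately have "AE x in \<theta>. x \<notin> b -` {1/2<..}" by (auto elim!: eventually_mono)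
    moreover have "b -` {1/2<..} \<in> sets \<theta>"
      using op radon_measureD(1)[OF haar_measureD(1)[OF \<theta>]] by simp
    ultimately have "emeasure \<theta> (b -` {1/2<..}) = 0"
      using AE_iff_null_sets null_setsD1 by blast
    moreover have "b -` {1/2<..} \<noteq> {}"
    proof -
      have "0 \<in> b -` {1/2<..}" using b(3) by simp
      then show ?thesis by (metis empty_iff)
    qed
    ultimately show False using haar_measure_open_pos[OF \<theta> op] by metis
  qed
  moreover have "I \<ge> 0" unfolding I_def using b(2) by simp
  ultimately have I: "I > 0" by simp
  have normg: "norm (g x) = b x" for x unfolding g_def using b(2) by (simp add: norm_mult)
  have fg: "fourier \<theta> g (- k) = complex_of_real I"
    unfolding fourier_def g_def I_def by (simp flip: mult.assoc)
  \<comment> \<open>The modulus of \<open>g\<close> also has integral \<open>I\<close>, so distance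
    1/2 between characters changes the transform by at most \<open>I / 2\<close>.\<close>
  have "eventually (char_near (supp g) (1/2) k) (nhds k)"
    by (rule eventually_char_near) (use KspaceD(2)[OF g] in auto)
  then obtain U where U: "open U" "k \<in> U" "\<And>l. l \<in> U \<Longrightarrow> char_near (supp g) (1/2) k l"
    unfolding eventually_nhds by blast
  show ?thesis
  proof (rule that[OF g U(1,2), of "I / 2"])
    fix l assume "l \<in> U"
    then have "char_near (supp g) (1/2) (- k) (- l)"
      using U(3)[of l] unfolding char_near_def dist_norm by (simp flip: complex_cnj_diff)
    from norm_fourier_diff_le[OF \<theta> g this]
    have "norm (fourier \<theta> g (- k) - fourier \<theta> g (- l)) \<le> I / 2"
      unfolding normg I_def by simp
    moreover have "I - norm (fourier \<theta> g (- l)) \<le> norm (complex_of_real I - fourier \<theta> g (- l))"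
      using norm_triangle_ineq2[of "complex_of_real I" "fourier \<theta> g (- l)"] I by simp
    ultimately show "I / 2 \<le> norm (fourier \<theta> g (- l))" unfolding fg by (simp add: field_simps)
  qed (use I in auto)
qed

text \<open>Passing to real parts gives a real integral, and bounding it by the norm is all that the
  estimates below use.\<close>

lemma has_fourier_transformD:
  assumes "has_fourier_transform \<theta> \<gamma> \<nu>"
  shows "radon_measure \<nu>"
    and "g \<in> Kspace \<Longrightarrow> integrable \<nu> (\<lambda>k. (norm (fourier \<theta> g (- k)))\<^sup>2)"
    and "g \<in> Kspace \<Longrightarrow> (LINT k|\<nu>. (norm (fourier \<theta> g (- k)))\<^sup>2) \<le> norm (\<gamma> (fun_conv \<theta> g (fun_tilde g)))"
proof -
  show "radon_measure \<nu>" using assms unfolding has_fourier_transform_def by blast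
  assume g: "g \<in> Kspace"
  then have *: "has_bochner_integral \<nu> (\<lambda>k. complex_of_real ((norm (fourier \<theta> g (- k)))\<^sup>2))
      (\<gamma> (fun_conv \<theta> g (fun_tilde g)))"
    using assms unfolding has_fourier_transform_def by blast
  then have "has_bochner_integral \<nu> (\<lambda>k. Re (complex_of_real ((norm (fourier \<theta> g (- k)))\<^sup>2)))
      (Re (\<gamma> (fun_conv \<theta> g (fun_tilde g))))"
    by (rule has_bochner_integral_Re)
  then have re: "has_bochner_integral \<nu> (\<lambda>k. (norm (fourier \<theta> g (- k)))\<^sup>2)
      (Re (\<gamma> (fun_conv \<theta> g (fun_tilde g))))" by (simp only: Re_complex_of_real)
  then show "integrable \<nu> (\<lambda>k. (norm (fourier \<theta> g (- k)))\<^sup>2)" by (rule integrable.intros)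
  from re show "(LINT k|\<nu>. (norm (fourier \<theta> g (- k)))\<^sup>2) \<le> norm (\<gamma> (fun_conv \<theta> g (fun_tilde g)))"
    using complex_Re_le_cmod by (simp add: has_bochner_integral_iff)
qed

text \<open>Finitely many \<open>U k\<close> cover \<open>K\<close>, each with a transform bounded
  below by \<open>c k\<close>. Modulation carries these lower bounds to \<open>t + K\<close>, and
  Markov's inequality bounds each piece by \<open>B k\<close> over the square of \<open>c k\<close>,
  independently of \<open>t\<close>.\<close>

lemma translation_bounded_posI:
  fixes \<theta> :: "'a::{topological_ab_group_add, t2_space} measure"
  assumes lc: "locally_compact_space (euclidean :: 'a topology)" and \<theta>: "haar_measure \<theta>"
    and ft: "has_fourier_transform \<theta> \<gamma> \<nu>"
    and bound: "\<And>g. g \<in> Kspace \<Longrightarrow> \<exists>B. \<forall>g'. (\<forall>x. norm (g' x) = norm (g x)) \<longrightarrow>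
      norm (\<gamma> (fun_conv \<theta> g' (fun_tilde g'))) \<le> B"
  shows "translation_bounded_pos \<nu>"
  unfolding translation_bounded_pos_def
proof (intro allI impI)
  fix K :: "'a dual_group set" assume K: "compact K"
  note \<nu> = has_fourier_transformD(1)[OF ft]
  have "\<forall>k. \<exists>g U c. g \<in> Kspace \<and> open U \<and> k \<in> U \<and> c > 0 \<and> (\<forall>l\<in>U. norm (fourier \<theta> g (- l)) \<ge> c)"
    by (meson exists_fourier_bounded_below[OF lc \<theta>])
  then obtain g U c where g: "\<And>k. g k \<in> Kspace" and U: "\<And>k. open (U k)" "\<And>k. k \<in> U k"
    and c: "\<And>k. c k > 0" "\<And>k l. l \<in> U k \<Longrightarrow> norm (fourier \<theta> (g k) (- l)) \<ge> c k"
    by metis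
  obtain B where B: "\<And>k g'. (\<And>x. norm (g' x) = norm (g k x)) \<Longrightarrow>
      norm (\<gamma> (fun_conv \<theta> g' (fun_tilde g'))) \<le> B k"
    using bound[OF g] by metis
  obtain J where J: "finite J" "K \<subseteq> (\<Union>k\<in>J. U k)"
    using compactE_image[OF K, of K U] U by (metis UN_I subsetI)
  have "emeasure \<nu> ((+) t ` K) \<le> (\<Sum>k\<in>J. ennreal (1 / (c k)\<^sup>2 * B k))" for t
  proof -
    define G where "G k x = cnj (char_app t x) * g k x" for k x
    have G: "G k \<in> Kspace" for k
      unfolding G_def using KspaceD[OF g]
      by (intro KspaceI[of _ "supp (g k)"]) (auto intro!: continuous_intros)
    have fG: "fourier \<theta> (G k) (- (t + l)) = fourier \<theta> (g k) (- l)" for k l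
    proof -
      have *: "(char_app t x * char_app l x) * (cnj (char_app t x) * z) = char_app l x * z" for x z
      proof -
        have "char_app t x * cnj (char_app t x) = 1" by simp
        then show ?thesis by algebra
      qed
      show ?thesis
        unfolding fourier_def G_def by (intro Bochner_Integration.integral_cong refl) (simp add: *)
    qed
    \<comment> \<open>Superlevel sets of the modulated transforms; they cover \<open>t + K\<close>
      and have the form to which Markov's inequality applies.\<close>
    define M where "M k = {l \<in> space \<nu>. (norm (fourier \<theta> (G k) (- l)))\<^sup>2 \<ge> (c k)\<^sup>2}" for k
    note int = has_fourier_transformD(2)[OF ft G]
    have M: "M k \<in> sets \<nu>" for k
      unfolding M_def using borel_measurable_integrable[OF int[of k]] by measurable
    have "(+) t ` K \<subseteq> (\<Union>k\<in>J. M k)"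
    proof
      fix m assume "m \<in> (+) t ` K"
      then obtain l k where l: "m = t + l" "k \<in> J" "l \<in> U k" using J(2) by blast
      then have "(c k)\<^sup>2 \<le> (norm (fourier \<theta> (G k) (- m)))\<^sup>2"
        using c(1)[of k] c(2)[OF l(3)] unfolding l(1) fG by (intro power_mono) auto
      then show "m \<in> (\<Union>k\<in>J. M k)" using l radon_measureD(2)[OF \<nu>] by (auto simp: M_def)
    qed
    then have "emeasure \<nu> ((+) t ` K) \<le> emeasure \<nu> (\<Union>k\<in>J. M k)"
      using J M by (intro emeasure_mono) auto
    also have "\<dots> \<le> (\<Sum>k\<in>J. emeasure \<nu> (M k))"
      using J M by (intro emeasure_subadditive_finite) auto
    also have "\<dots> \<le> (\<Sum>k\<in>J. ennreal (1 / (c k)\<^sup>2 * B k))"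
    proof (rule sum_mono)
      fix k
      have "emeasure \<nu> (M k) \<le> ennreal (1 / (c k)\<^sup>2 * (LINT l|\<nu>. (norm (fourier \<theta> (G k) (- l)))\<^sup>2))"
        unfolding M_def using c(1)[of k] by (intro integral_Markov_inequality[OF int]) auto
      also have "\<dots> \<le> ennreal (1 / (c k)\<^sup>2 * B k)"
      proof (intro ennreal_leI mult_left_mono)
        have "norm (G k x) = norm (g k x)" for x by (simp add: G_def norm_mult)
        then show "(LINT l|\<nu>. (norm (fourier \<theta> (G k) (- l)))\<^sup>2) \<le> B k"
          by (rule order_trans[OF has_fourier_transformD(3)[OF ft G] B])
      qed simp
      finally show "emeasure \<nu> (M k) \<le> ennreal (1 / (c k)\<^sup>2 * B k)" .
    qed
    finally show ?thesis .
  qed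
  then have "(SUP t. emeasure \<nu> ((+) t ` K)) \<le> (\<Sum>k\<in>J. ennreal (1 / (c k)\<^sup>2 * B k))"
    by (intro SUP_least)
  also have "\<dots> < \<infinity>" using J(1) by (simp add: less_top[symmetric])
  finally show "(SUP t. emeasure \<nu> ((+) t ` K)) < \<infinity>" .
qed

subsection \<open>Means over finitely many points and Wiener's argument\<close>

text \<open>\<open>avg xs\<close> is integration against the convolution of the probability measures
  \<open>(\<delta>\<^sub>0 + \<delta>\<^sub>x) / 2\<close> for \<open>x\<close> in \<open>xs\<close>.\<close>

fun avg :: "'a::ab_group_add list \<Rightarrow> ('a \<Rightarrow> complex) \<Rightarrow> complex" where
  "avg [] f = f 0"
| "avg (x # xs) f = (avg xs f + avg xs (\<lambda>y. f (x + y))) / 2"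

lemma avg_mult: "avg xs (\<lambda>y. c * f y) = c * avg xs f"
  by (induction xs arbitrary: f) (simp_all add: distrib_left)

lemma avg_sum: "avg xs (\<lambda>y. \<Sum>i\<in>I. f i y) = (\<Sum>i\<in>I. avg xs (f i))"
  by (induction xs arbitrary: f) (simp_all add: sum.distrib flip: sum_divide_distrib)

lemma Re_avg_ge: "(\<And>y. c \<le> Re (f y)) \<Longrightarrow> c \<le> Re (avg xs f)"
proof (induction xs arbitrary: f)
  case (Cons x xs)
  have "c \<le> Re (avg xs f)" "c \<le> Re (avg xs (\<lambda>y. f (x + y)))"
    by (rule Cons.IH, rule Cons.prems)+
  then show ?case by simp
qed simp

lemma avg_integral:
  assumes "\<And>y. integrable M (f y)"
  shows "integrable M (\<lambda>k. avg xs (\<lambda>y. f y k))"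
    and "avg xs (\<lambda>y. LINT k|M. f y k) = (LINT k|M. avg xs (\<lambda>y. f y k))"
proof -
  have "integrable M (\<lambda>k. avg xs (\<lambda>y. f y k)) \<and>
      avg xs (\<lambda>y. LINT k|M. f y k) = (LINT k|M. avg xs (\<lambda>y. f y k))"
    using assms
  proof (induction xs arbitrary: f)
    case (Cons x xs)
    note 1 = Cons.IH[of f, OF Cons.prems] and 2 = Cons.IH[of "\<lambda>y. f (x + y)", OF Cons.prems]
    show ?case using 1 2 by simp
  qed simp
  then show "integrable M (\<lambda>k. avg xs (\<lambda>y. f y k))"
    and "avg xs (\<lambda>y. LINT k|M. f y k) = (LINT k|M. avg xs (\<lambda>y. f y k))" by auto
qed

text \<open>A character turns the convolution behind \<open>avg\<close> into a product, with one
  factor for each listed point.\<close>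

lemma avg_char_Cons: "avg (x # xs) (char_app k) = (1 + char_app k x) / 2 * avg xs (char_app k)"
proof -
  have "avg xs (\<lambda>y. char_app k (x + y)) = char_app k x * avg xs (char_app k)"
    unfolding char_add by (rule avg_mult)
  then show ?thesis by (simp add: field_simps)
qed

lemma avg_char_append: "avg (xs @ ys) (char_app k) = avg xs (char_app k) * avg ys (char_app k)"
  by (induction xs) (simp_all add: avg_char_Cons del: avg.simps(2))

lemma avg_char_replicate: "avg (replicate n x) (char_app k) = ((1 + char_app k x) / 2) ^ n"
  by (induction n) (simp_all add: avg_char_Cons del: avg.simps(2))

lemma norm_avg_char_le: "norm (avg xs (char_app k)) \<le> 1"
proof (induction xs)
  case (Cons x xs)
  have "norm (1 + char_app k x) \<le> 2" using norm_triangle_ineq[of 1 "char_app k x"] by simp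
  then have "norm ((1 + char_app k x) / 2) \<le> 1" by (simp add: norm_divide)
  then show ?case unfolding avg_char_Cons norm_mult by (intro mult_le_one Cons.IH) auto
qed simp

lemma continuous_on_avg_char: "continuous_on UNIV (\<lambda>k. avg xs (char_app k))"
  by (induction xs) (auto simp: avg_char_Cons simp del: avg.simps(2)
      intro!: continuous_intros continuous_on_char_eval)

text \<open>By the parallelogram law a value \<open>k(x)\<close> other than 1 makes
  \<open>(1 + k(x)) / 2\<close> strictly smaller than 1 in modulus; repeating \<open>x\<close> takes
  powers of it.\<close>

lemma avg_char_small:
  assumes "k \<noteq> 0" "\<delta> > 0"
  obtains xs where "norm (avg xs (char_app k)) < \<delta>"
proof -
  obtain x where x: "char_app k x \<noteq> 1"
    using assms(1) by (auto simp flip: char_app_inject simp: zero_dual_group.rep_eq)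
  define r where "r = norm ((1 + char_app k x) / 2)"
  have "(norm (1 + char_app k x))\<^sup>2 + (norm (1 - char_app k x))\<^sup>2 = 4"
  proof -
    have "(Re (char_app k x))\<^sup>2 + (Im (char_app k x))\<^sup>2 = 1"
      by (metis cmod_power2 char_norm one_power2)
    then show ?thesis unfolding cmod_power2 by (simp add: power2_eq_square algebra_simps)
  qed
  moreover have "(norm (1 - char_app k x))\<^sup>2 > 0" using x by simp
  ultimately have "(norm (1 + char_app k x))\<^sup>2 < 4" by linarith
  then have "(norm (1 + char_app k x))\<^sup>2 < 2\<^sup>2" by simp
  then have "norm (1 + char_app k x) < 2" by (rule power_less_imp_less_base) simp
  then have r: "0 \<le> r" "r < 1" by (simp_all add: r_def norm_divide)
  then obtain n where "r ^ n < \<delta>" using real_arch_pow_inv[OF assms(2)] by blast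
  then have "norm (avg (replicate n x) (char_app k)) < \<delta>"
    unfolding avg_char_replicate norm_power r_def .
  then show ?thesis by (rule that)
qed

text \<open>Concatenation of lists multiplies means of modulus at most 1, so the joint list is at
  least as good as each part, for every character at once.\<close>

lemma avg_char_common:
  assumes "finite I"
  shows "\<exists>zs. \<forall>i\<in>I. \<forall>k. norm (avg zs (char_app k)) \<le> norm (avg (f i) (char_app k))"
  using assms
proof induction
  case (insert i I)
  then obtain zs where zs: "\<forall>i\<in>I. \<forall>k. norm (avg zs (char_app k)) \<le> norm (avg (f i) (char_app k))"
    by blast
  have "norm (avg (f i @ zs) (char_app k)) \<le> norm (avg (f j) (char_app k))" if j: "j \<in> insert i I" for j k
  proof (cases "j = i")
    case True
    then show ?thesis
      unfolding avg_char_append norm_mult using norm_avg_char_le[of zs k] by (auto intro: mult_left_le)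
  next
    case False
    have "norm (avg (f i @ zs) (char_app k)) \<le> norm (avg zs (char_app k))"
      unfolding avg_char_append norm_mult
      using norm_avg_char_le[of "f i" k] by (auto intro: mult_left_le_one_le)
    also have "\<dots> \<le> norm (avg (f j) (char_app k))" using zs j False by blast
    finally show ?thesis .
  qed
  then show ?case by blast
qed simp

section \<open>Wiener's argument on a compact set without atoms\<close>

lemma norm_integral_le_const:
  fixes f :: "'b \<Rightarrow> 'c::{banach, second_countable_topology}"
  assumes "finite_measure M" "\<And>x. x \<in> space M \<Longrightarrow> norm (f x) \<le> B" "B \<ge> 0"
  shows "norm (LINT x|M. f x) \<le> B * measure M (space M)"
proof -
  interpret finite_measure M by fact
  have "norm (LINT x|M. f x) \<le> (LINT x|M. norm (f x))" by (rule integral_norm_bound)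
  also have "\<dots> \<le> (LINT x|M. B)"
    using assms by (intro integral_mono_AE') auto
  finally show ?thesis by (simp add: mult.commute)
qed

lemma restrict_radon:
  fixes \<nu> :: "'a::t2_space measure"
  assumes \<nu>: "radon_measure \<nu>" and C: "compact C"
  defines "\<rho> \<equiv> restrict_space \<nu> C"
  shows "finite_measure \<rho>" "space \<rho> = C" "\<And>B. B \<in> sets borel \<Longrightarrow> B \<subseteq> C \<Longrightarrow> B \<in> sets \<rho>"
    "\<And>B. B \<subseteq> C \<Longrightarrow> emeasure \<rho> B = emeasure \<nu> B"
    "\<And>f. continuous_on UNIV f \<Longrightarrow> f \<in> borel_measurable \<rho>"
proof -
  note s = radon_measureD(1,2)[OF \<nu>]
  have Cs: "C \<in> sets borel" using C by (intro borel_closed compact_imp_closed)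
  show sp: "space \<rho> = C" unfolding \<rho>_def by (simp add: space_restrict_space s)
  show em: "emeasure \<rho> B = emeasure \<nu> B" if "B \<subseteq> C" for B
    unfolding \<rho>_def using that Cs s by (intro emeasure_restrict_space) auto
  show "finite_measure \<rho>"
    using em[of C] radon_measureD(3)[OF \<nu> C] sp by (intro finite_measureI) auto
  show "B \<in> sets \<rho>" if "B \<in> sets borel" "B \<subseteq> C" for B
    unfolding \<rho>_def using that Cs s by (subst sets_restrict_space_iff) auto
  show "f \<in> borel_measurable \<rho>" if "continuous_on UNIV f" for f
    unfolding \<rho>_def by (intro measurable_restrict_space1 borel_measurable_radon[OF \<nu> that])
qed

text \<open>Since \<open>l0\<close> is not an atom, a compact \<open>K\<close> avoiding it carries
  all but \<open>\<delta> / 2\<close> of the mass. On \<open>K\<close> the differences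
  \<open>k - l0\<close> are nonzero, so a finite cover and concatenation give one list with small
  means there; off \<open>K\<close> the trivial bound 1 suffices.\<close>

lemma wiener_means_local:
  fixes \<nu> :: "'a::topological_ab_group_add dual_group measure"
  assumes \<nu>: "radon_measure \<nu>" and C: "compact C" and l0: "l0 \<in> C" "emeasure \<nu> {l0} = 0"
    and \<delta>: "\<delta> > 0"
  defines "\<rho> \<equiv> restrict_space \<nu> C"
  obtains xs N where "open N" "l0 \<in> N"
    "\<And>l. l \<in> N \<Longrightarrow> (LINT k|\<rho>. norm (avg xs (char_app (k - l)))) \<le> \<delta>"
proof -
  note \<rho> = restrict_radon[OF \<nu> C, folded \<rho>_def]
  interpret finite_measure \<rho> by (rule \<rho>(1))
  define \<mu> where "\<mu> = measure \<rho> C"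
  have \<mu>: "\<mu> \<ge> 0" by (simp add: \<mu>_def)
  note s = radon_measureD(1)[OF \<nu>]
  have Cs: "C \<in> sets borel" using C by (intro borel_closed compact_imp_closed)
  obtain K where K: "compact K" "K \<subseteq> C - {l0}" "measure \<rho> (C - K) \<le> \<delta> / 2"
  proof (cases "emeasure \<nu> C = 0")
    case True
    then have "measure \<rho> C = 0" using \<rho>(4)[of C] by (simp add: measure_def)
    then show ?thesis using \<delta> by (intro that[of "{}"]) auto
  next
    case False
    have fin: "emeasure \<nu> C < \<infinity>" by (rule radon_measureD(3)[OF \<nu> C])
    have "emeasure \<nu> C - ennreal (\<delta> / 2) < emeasure \<nu> C"
      using False fin \<delta> by (intro ennreal_between) (auto simp: zero_less_iff_neq_zero)
    moreover have "emeasure \<nu> (C - {l0}) = emeasure \<nu> C"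
      using Cs l0(2) s by (intro emeasure_Diff_null_set) (auto simp: null_sets_def)
    moreover have "emeasure \<nu> (C - {l0}) = (SUP K\<in>{K. compact K \<and> K \<subseteq> C - {l0}}. emeasure \<nu> K)"
      using Cs by (intro radon_measureD(4)[OF \<nu>]) auto
    ultimately have "emeasure \<nu> C - ennreal (\<delta> / 2) <
        (SUP K\<in>{K. compact K \<and> K \<subseteq> C - {l0}}. emeasure \<nu> K)" by metis
    then obtain K where K: "compact K" "K \<subseteq> C - {l0}" "emeasure \<nu> C - ennreal (\<delta> / 2) < emeasure \<nu> K"
      unfolding less_SUP_iff by blast
    have Ks: "K \<in> sets borel" using K(1) by (intro borel_closed compact_imp_closed)
    have KC: "K \<subseteq> C" using K(2) by blast
    have "ennreal \<mu> - ennreal (\<delta> / 2) < ennreal (measure \<rho> K)"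
      using K(3) \<rho>(4)[OF KC] \<rho>(4)[of C] emeasure_eq_measure[of K] emeasure_eq_measure[of C]
      by (simp add: \<mu>_def)
    \<comment> \<open>Subtraction in \<open>ennreal\<close> is truncated at 0; when truncation
      occurs, the left side here is at most 0 and the inequality still holds.\<close>
    then have "\<mu> - \<delta> / 2 < measure \<rho> K"
      using \<delta> by (simp add: ennreal_minus ennreal_less_iff split: if_splits)
        (smt (verit) ennreal_less_iff measure_nonneg ennreal_neg)
    moreover have "measure \<rho> (C - K) = \<mu> - measure \<rho> K"
      unfolding \<mu>_def using KC Ks Cs by (intro finite_measure_Diff \<rho>(3)) auto
    ultimately show ?thesis using K by (intro that[of K]) auto
  qed
  \<comment> \<open>Chosen so that \<open>\<delta>' * \<mu>\<close> is at most
    \<open>\<delta> / 2\<close>; the added 1 keeps the denominator positive when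
    \<open>\<mu> = 0\<close>.\<close>
  define \<delta>' where "\<delta>' = \<delta> / (2 * (\<mu> + 1))"
  have \<delta>': "\<delta>' > 0" using \<delta> \<mu> by (simp add: \<delta>'_def)
  \<comment> \<open>Smallness is needed jointly in both arguments: the neighbourhood
    \<open>N\<close> of \<open>l0\<close> must not depend on the point of \<open>U\<close>, so that
    finitely many such neighbourhoods can be intersected.\<close>
  define good where "good k xs U N \<longleftrightarrow> open U \<and> open N \<and> k \<in> U \<and> l0 \<in> N \<and>
      (\<forall>k'\<in>U. \<forall>l'\<in>N. norm (avg xs (char_app (k' - l'))) < \<delta>')" for k xs U N
  have "\<exists>xs U N. good k xs U N" if "k \<in> K" for k
  proof -
    have "k - l0 \<noteq> 0" using that K(2) by auto
    then obtain xs where xs: "norm (avg xs (char_app (k - l0))) < \<delta>'"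
      using avg_char_small[OF _ \<delta>'] by blast
    have "continuous_on UNIV (\<lambda>p::'a dual_group \<times> 'a dual_group. fst p - snd p)"
      by (intro continuous_intros)
    then have "continuous_on UNIV (\<lambda>p::'a dual_group \<times> 'a dual_group. avg xs (char_app (fst p - snd p)))"
      by (rule continuous_on_compose2[OF continuous_on_avg_char]) auto
    then have "continuous_on UNIV (\<lambda>p::'a dual_group \<times> 'a dual_group. norm (avg xs (char_app (fst p - snd p))))"
      by (intro continuous_intros)
    then have "open ((\<lambda>p::'a dual_group \<times> 'a dual_group. norm (avg xs (char_app (fst p - snd p)))) -` {..<\<delta>'})"
      (is "open ?W") by (simp add: continuous_on_open_vimage)
    moreover have "(k, l0) \<in> ?W" using xs by simp
    ultimately obtain U N where UN: "open U" "open N" "(k, l0) \<in> U \<times> N" "U \<times> N \<subseteq> ?W"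
      by (rule open_prod_elim)
    have "norm (avg xs (char_app (k' - l'))) < \<delta>'" if "k' \<in> U" "l' \<in> N" for k' l'
      using subsetD[OF UN(4), of "(k', l')"] that by simp
    then show ?thesis unfolding good_def using UN(1-3) by blast
  qed
  then obtain f U N where good: "\<And>k. k \<in> K \<Longrightarrow> good k (f k) (U k) (N k)" by metis
  have f: "open (U k)" "open (N k)" "k \<in> U k" "l0 \<in> N k"
      "\<And>k' l'. k' \<in> U k \<Longrightarrow> l' \<in> N k \<Longrightarrow> norm (avg (f k) (char_app (k' - l'))) < \<delta>'"
    if "k \<in> K" for k using good[OF that] unfolding good_def by auto
  obtain J where J: "J \<subseteq> K" "finite J" "K \<subseteq> (\<Union>k\<in>J. U k)"
    using compactE_image[OF K(1), of K U] f(1,3) by (metis UN_I subsetI)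
  obtain zs where zs: "\<And>i k. i \<in> J \<Longrightarrow> norm (avg zs (char_app k)) \<le> norm (avg (f i) (char_app k))"
    using avg_char_common[OF J(2), of f] by blast
  show ?thesis
  proof (rule that[of "\<Inter>k\<in>J. N k" zs])
    show "open (\<Inter>k\<in>J. N k)" using J f(2) by (intro open_INT) auto
    show "l0 \<in> (\<Inter>k\<in>J. N k)" using J f(4) by auto
    fix l assume l: "l \<in> (\<Inter>k\<in>J. N k)"
    have Ks: "C - K \<in> sets \<rho>"
      using K(1) Cs by (intro \<rho>(3) sets.Diff) (auto intro: borel_closed compact_imp_closed)
    then have int: "integrable \<rho> (indicat_real (C - K))"
      by (intro integrable_real_indicator) (auto simp: less_top[symmetric])
    have pt: "norm (avg zs (char_app (k - l))) \<le> \<delta>' + indicat_real (C - K) k" if "k \<in> C" for k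
    proof (cases "k \<in> K")
      case True
      then obtain i where i: "i \<in> J" "k \<in> U i" using J by auto
      then show ?thesis using zs[OF i(1), of "k - l"] f(5)[of i k l] l J True by fastforce
    next
      case False
      then show ?thesis using that norm_avg_char_le[of zs "k - l"] \<delta>' by simp
    qed
    have "(LINT k|\<rho>. norm (avg zs (char_app (k - l)))) \<le> (LINT k|\<rho>. \<delta>' + indicat_real (C - K) k)"
      using int pt \<rho>(2) \<delta>' by (intro integral_mono_AE') (auto intro!: add_nonneg_nonneg)
    also have "\<dots> = \<delta>' * \<mu> + measure \<rho> (C - K)"
      using Ks \<rho>(2) int by (simp add: \<mu>_def Int_absorb2)
    also have "\<dots> \<le> \<delta> / 2 + \<delta> / 2"
    proof (rule add_mono[OF _ K(3)])
      have "\<delta> * \<mu> \<le> \<delta> * (\<mu> + 1)" using \<delta> by simp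
      then show "\<delta>' * \<mu> \<le> \<delta> / 2" using \<mu> by (simp add: \<delta>'_def field_simps)
    qed
    finally show "(LINT k|\<rho>. norm (avg zs (char_app (k - l)))) \<le> \<delta>" by simp
  qed
qed

text \<open>The second compactness argument, now in \<open>l\<close>: local lists are concatenated
  over a finite cover of \<open>C\<close>, which only decreases the integrands.\<close>

lemma wiener_means:
  fixes \<nu> :: "'a::topological_ab_group_add dual_group measure"
  assumes \<nu>: "radon_measure \<nu>" and C: "compact C" and atomless: "\<And>l. l \<in> C \<Longrightarrow> emeasure \<nu> {l} = 0"
    and \<delta>: "\<delta> > 0"
  defines "\<rho> \<equiv> restrict_space \<nu> C"
  obtains xs where "\<And>l. l \<in> C \<Longrightarrow> (LINT k|\<rho>. norm (avg xs (char_app (k - l)))) \<le> \<delta>"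
proof -
  note \<rho> = restrict_radon[OF \<nu> C, folded \<rho>_def]
  interpret finite_measure \<rho> by (rule \<rho>(1))
  have "\<exists>xs N. open N \<and> l0 \<in> N \<and> (\<forall>l\<in>N. (LINT k|\<rho>. norm (avg xs (char_app (k - l)))) \<le> \<delta>)"
    if "l0 \<in> C" for l0
    using wiener_means_local[OF \<nu> C that atomless[OF that] \<delta>, folded \<rho>_def] by metis
  then obtain f N where f: "\<And>k. k \<in> C \<Longrightarrow> open (N k)" "\<And>k. k \<in> C \<Longrightarrow> k \<in> N k"
      "\<And>k l. k \<in> C \<Longrightarrow> l \<in> N k \<Longrightarrow> (LINT m|\<rho>. norm (avg (f k) (char_app (m - l)))) \<le> \<delta>"
    by metis
  obtain J where J: "J \<subseteq> C" "finite J" "C \<subseteq> (\<Union>k\<in>J. N k)"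
    using compactE_image[OF C, of C N] f(1,2) by (metis UN_I subsetI)
  obtain zs where zs: "\<And>i k. i \<in> J \<Longrightarrow> norm (avg zs (char_app k)) \<le> norm (avg (f i) (char_app k))"
    using avg_char_common[OF J(2), of f] by blast
  show ?thesis
  proof (rule that)
    fix l assume "l \<in> C"
    then obtain i where i: "i \<in> J" "l \<in> N i" using J by blast
    have "continuous_on UNIV (\<lambda>k. avg (f i) (char_app (k - l)))"
      by (rule continuous_on_compose2[OF continuous_on_avg_char]) (auto intro!: continuous_intros)
    then have "(\<lambda>k. norm (avg (f i) (char_app (k - l)))) \<in> borel_measurable \<rho>"
      by (intro \<rho>(5) continuous_intros)
    then have "integrable \<rho> (\<lambda>k. norm (avg (f i) (char_app (k - l))))"
      using norm_avg_char_le by (intro integrable_const_bound[of _ 1]) auto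
    then have "(LINT k|\<rho>. norm (avg zs (char_app (k - l)))) \<le> (LINT k|\<rho>. norm (avg (f i) (char_app (k - l))))"
      using zs[OF i(1)] by (intro integral_mono_AE') auto
    also have "\<dots> \<le> \<delta>" using f(3)[OF _ i(2)] i J by blast
    finally show "(LINT k|\<rho>. norm (avg zs (char_app (k - l)))) \<le> \<delta>" .
  qed
qed

text \<open>The topology of the dual controls characters only on compact sets, so \<open>V\<close>
  is taken inside a compact neighbourhood of \<open>0\<close>. There, each character of
  \<open>C\<close> is compared with one of finitely many.\<close>

lemma compact_dual_equicontinuous:
  fixes C :: "'a::topological_ab_group_add dual_group set"
  assumes lc: "locally_compact_space (euclidean :: 'a topology)" and C: "compact C" and e: "e > 0"
  obtains V :: "'a set" where "open V" "0 \<in> V" "\<And>k v. k \<in> C \<Longrightarrow> v \<in> V \<Longrightarrow> norm (1 - char_app k v) < e"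
proof -
  obtain U K :: "'a set" where UK: "open U" "0 \<in> U" "U \<subseteq> K" "compact K"
    using locally_compact_group_compact_nhd[OF lc] by blast
  have "\<exists>N. open N \<and> k \<in> N \<and> (\<forall>l\<in>N. char_near K (e / 2) k l)" for k
    using eventually_char_near[OF UK(4), of "e / 2" k] e unfolding eventually_nhds by auto
  then obtain N where N: "\<And>k. open (N k)" "\<And>k. k \<in> N k" "\<And>k l. l \<in> N k \<Longrightarrow> char_near K (e / 2) k l"
    by metis
  obtain J where J: "finite J" "C \<subseteq> (\<Union>k\<in>J. N k)"
    using compactE_image[OF C, of C N] N(1,2) by (metis UN_I subsetI)
  define W where "W k = (\<lambda>v. norm (1 - char_app k v)) -` {..<e / 2}" for k :: "'a dual_group"
  have W: "open (W k)" "0 \<in> W k" for k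
  proof -
    have "continuous_on UNIV (\<lambda>v. norm (1 - char_app k v))" by (intro continuous_intros)
    then show "open (W k)" unfolding W_def by (simp add: continuous_on_open_vimage)
  qed (use e in \<open>simp add: W_def\<close>)
  show ?thesis
  proof (rule that[of "U \<inter> (\<Inter>k\<in>J. W k)"])
    show "open (U \<inter> (\<Inter>k\<in>J. W k))" using J W(1) UK(1) by (intro open_Int open_INT) auto
    show "0 \<in> U \<inter> (\<Inter>k\<in>J. W k)" using UK(2) W(2) by auto
    fix l v assume l: "l \<in> C" and v: "v \<in> U \<inter> (\<Inter>k\<in>J. W k)"
    then obtain k where k: "k \<in> J" "l \<in> N k" using J by blast
    have "norm (char_app k v - char_app l v) < e / 2"
      using N(3)[OF k(2)] v UK(3) unfolding char_near_def dist_norm by blast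
    moreover have "norm (1 - char_app k v) < e / 2" using v k by (auto simp: W_def)
    moreover have "norm (1 - char_app l v) \<le> norm (1 - char_app k v) + norm (char_app k v - char_app l v)"
      using norm_triangle_ineq[of "1 - char_app k v" "char_app k v - char_app l v"] by simp
    ultimately show "norm (1 - char_app l v) < e" by linarith
  qed
qed

subsection \<open>Pure point diffraction\<close>

lemma relatively_dense_mono: "relatively_dense P \<Longrightarrow> P \<subseteq> Q \<Longrightarrow> relatively_dense Q"
proof -
  assume "relatively_dense P" and PQ: "P \<subseteq> Q"
  then obtain K where K: "compact K" "{p + k |p k. p \<in> P \<and> k \<in> K} = UNIV"
    unfolding relatively_dense_def by blast
  have "{p + k |p k. p \<in> P \<and> k \<in> K} \<subseteq> {p + k |p k. p \<in> Q \<and> k \<in> K}" using PQ by blast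
  then show "relatively_dense Q" unfolding relatively_dense_def using K by auto
qed

text \<open>The transform \<open>F\<close> of the restriction of \<open>\<nu>\<close> to \<open>C\<close> stays close to
  \<open>\<nu> C\<close> on a set of which finitely many translates cover the group, whereas the means of
  \<open>\<bar>F\<bar>\<^sup>2\<close> can be made small, uniformly over translates, when there are no atoms.\<close>

lemma almost_periodic_atomless_null:
  fixes \<nu> :: "'a::topological_ab_group_add dual_group measure"
  assumes lc: "locally_compact_space (euclidean :: 'a topology)"
    and \<nu>: "radon_measure \<nu>" and C: "compact C" and atomless: "\<And>l. l \<in> C \<Longrightarrow> emeasure \<nu> {l} = 0"
    and dense: "\<And>\<epsilon>. \<epsilon> > 0 \<Longrightarrow>
      relatively_dense {t. (LINT k|restrict_space \<nu> C. (norm (1 - char_app k t))\<^sup>2) \<le> \<epsilon>}"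
  shows "emeasure \<nu> C = 0"
proof (rule ccontr)
  assume pos: "emeasure \<nu> C \<noteq> 0"
  define \<rho> where "\<rho> = restrict_space \<nu> C"
  note \<rho> = restrict_radon[OF \<nu> C, folded \<rho>_def]
  interpret finite_measure \<rho> by (rule \<rho>(1))
  define \<mu> where "\<mu> = measure \<rho> C"
  have \<mu>: "\<mu> > 0"
    using pos \<rho>(4)[of C] emeasure_eq_measure[of C] measure_nonneg[of \<rho> C]
    unfolding \<mu>_def by (cases "measure \<rho> C = 0") (auto simp: less_le)
  define F where "F y = (LINT k|\<rho>. char_app k y)" for y
  have meas: "(\<lambda>k. char_app k y) \<in> borel_measurable \<rho>" for y
    by (rule \<rho>(5)[OF continuous_on_char_eval])
  have int: "integrable \<rho> (\<lambda>k. char_app k y)" for y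
    by (intro integrable_const_bound[of _ 1] meas) auto
  \<comment> \<open>With the tolerance \<open>\<mu> / 2\<close>, the real part of \<open>F\<close>
    is at least \<open>3/4 * \<mu>\<close> on \<open>E\<close>; a shift by \<open>V\<close> costs at
    most \<open>\<mu> / 4\<close> and leaves \<open>\<mu> / 2\<close>.\<close>
  define E where "E = {t. (LINT k|\<rho>. (norm (1 - char_app k t))\<^sup>2) \<le> \<mu> / 2}"
  obtain V :: "'a set" where V: "open V" "0 \<in> V" "\<And>k v. k \<in> C \<Longrightarrow> v \<in> V \<Longrightarrow> norm (1 - char_app k v) < 1/4"
  proof (rule compact_dual_equicontinuous[OF lc C, of "1/4"])
    show "(0::real) < 1/4" by simp
  qed (rule that)
  have big: "\<mu>\<^sup>2 / 4 \<le> Re (F (t + v) * cnj (F (t + v)))" if "t \<in> E" "v \<in> V" for t v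
  proof -
    have "(LINT k|\<rho>. (norm (1 - char_app k t))\<^sup>2) = 2 * (\<mu> - Re (F t))"
      unfolding norm_one_minus_char_app_sq F_def using int[of t] by (simp add: \<mu>_def \<rho>(2))
    then have 1: "Re (F t) \<ge> 3 / 4 * \<mu>" using that(1) by (simp add: E_def)
    have "F t - F (t + v) = (LINT k|\<rho>. char_app k t - char_app k (t + v))"
      unfolding F_def using int by simp
    also have "norm \<dots> \<le> 1/4 * measure \<rho> (space \<rho>)"
    proof (rule norm_integral_le_const[OF \<rho>(1)])
      fix k assume "k \<in> space \<rho>"
      then have "norm (1 - char_app k v) \<le> 1/4" using V(3)[OF _ that(2)] \<rho>(2) by (simp add: less_imp_le)
      moreover have "char_app k t - char_app k (t + v) = char_app k t * (1 - char_app k v)"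
        by (simp add: char_add algebra_simps)
      ultimately show "norm (char_app k t - char_app k (t + v)) \<le> 1/4" by (simp add: norm_mult)
    qed simp
    finally have 2: "norm (F t - F (t + v)) \<le> 1/4 * \<mu>" by (simp add: \<rho>(2) \<mu>_def)
    have "\<mu> / 2 \<le> Re (F (t + v))"
      using 1 2 complex_Re_le_cmod[of "F t - F (t + v)"] by simp
    then have "\<mu> / 2 \<le> norm (F (t + v))" using complex_Re_le_cmod order_trans by blast
    then have "(\<mu> / 2)\<^sup>2 \<le> (norm (F (t + v)))\<^sup>2" using \<mu> by (intro power_mono) auto
    then show ?thesis by (simp add: complex_norm_square[symmetric] power_divide)
  qed
  have "relatively_dense E" unfolding E_def \<rho>_def using \<mu> by (intro dense) simp
  then obtain K where K: "compact K" "{p + k |p k. p \<in> E \<and> k \<in> K} = UNIV"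
    unfolding relatively_dense_def by blast
  obtain A where A: "finite A" "K \<subseteq> (\<Union>a\<in>A. (+) a ` V)"
    using compact_finite_translates[OF K(1) V(1,2)] by blast
  \<comment> \<open>This is the squared modulus of \<open>F (y - a)\<close>. Since
    \<open>E + A + V\<close> is the whole group, at each \<open>y\<close> some \<open>G a y\<close>
    with \<open>a\<close> in \<open>A\<close> is large.\<close>
  define G where "G a y = F (y - a) * cnj (F (y - a))" for a y
  have G0: "0 \<le> Re (G a y)" for a y
    unfolding G_def by (simp add: complex_norm_square[symmetric])
  have cover: "\<mu>\<^sup>2 / 4 \<le> Re (\<Sum>a\<in>A. G a y)" for y
  proof -
    have "y \<in> {p + k |p k. p \<in> E \<and> k \<in> K}" using K(2) by simp
    then obtain p k where pk: "y = p + k" "p \<in> E" "k \<in> K" by blast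
    then obtain a v where av: "a \<in> A" "v \<in> V" "k = a + v" using A(2) by blast
    have "y - a = p + v" using pk av by simp
    then have "\<mu>\<^sup>2 / 4 \<le> Re (G a y)" using big[OF pk(2) av(2)] by (simp add: G_def)
    also have "\<dots> \<le> (\<Sum>a\<in>A. Re (G a y))" using A(1) av(1) G0 by (intro member_le_sum) auto
    finally show ?thesis by simp
  qed
  \<comment> \<open>Makes the mean of the sum over \<open>A\<close> at most
    \<open>\<mu>\<^sup>2 / 8\<close>, half of the lower bound from \<open>cover\<close>.\<close>
  define \<delta> where "\<delta> = \<mu> / (8 * (real (card A) + 1))"
  have \<delta>: "\<delta> > 0" using \<mu> by (simp add: \<delta>_def)
  obtain xs where xs: "\<And>l. l \<in> C \<Longrightarrow> (LINT k|\<rho>. norm (avg xs (char_app (k - l)))) \<le> \<delta>"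
    using wiener_means[OF \<nu> C atomless \<delta>, folded \<rho>_def] by blast
  have small: "norm (avg xs (G a)) \<le> \<delta> * \<mu>" for a
  proof -
    \<comment> \<open>Absorbs the shift by \<open>a\<close> into a factor of modulus 1, so the bound
      on means at \<open>k - l\<close> applies uniformly in \<open>a\<close>.\<close>
    define c where "c l k = cnj (char_app (k - l) a)" for l k :: "'a dual_group"
    have split: "c l k * char_app (k - l) y = char_app k (y - a) * cnj (char_app l (y - a))" for l k y
      unfolding c_def by (simp add: char_app_diff)
    have inti: "integrable \<rho> (\<lambda>k. c l k * char_app (k - l) y)" for l y
      unfolding split using int by simp
    \<comment> \<open>The inner integral is \<open>F\<close> times a constant, so integrability in
      \<open>l\<close> is immediate and the means can be moved inside each integral in turn.\<close>
    have Fl: "F (y - a) * cnj (char_app l (y - a)) = (LINT k|\<rho>. c l k * char_app (k - l) y)" for l y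
      unfolding split F_def by simp
    have into: "integrable \<rho> (\<lambda>l. LINT k|\<rho>. c l k * char_app (k - l) y)" for y
      unfolding Fl[symmetric] using int[of "y - a"] by simp
    have "G a = (\<lambda>y. LINT l|\<rho>. LINT k|\<rho>. c l k * char_app (k - l) y)"
    proof
      fix y
      have "G a y = (LINT l|\<rho>. F (y - a) * cnj (char_app l (y - a)))"
        unfolding G_def F_def by simp
      then show "G a y = (LINT l|\<rho>. LINT k|\<rho>. c l k * char_app (k - l) y)" unfolding Fl .
    qed
    then have "avg xs (G a) = (LINT l|\<rho>. avg xs (\<lambda>y. LINT k|\<rho>. c l k * char_app (k - l) y))"
      using avg_integral(2)[of \<rho> "\<lambda>y l. LINT k|\<rho>. c l k * char_app (k - l) y", OF into] by simp
    also have "\<dots> = (LINT l|\<rho>. LINT k|\<rho>. c l k * avg xs (char_app (k - l)))"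
    proof -
      have "avg xs (\<lambda>y. LINT k|\<rho>. c l k * char_app (k - l) y)
          = (LINT k|\<rho>. c l k * avg xs (char_app (k - l)))" for l
        using avg_integral(2)[of \<rho> "\<lambda>y k. c l k * char_app (k - l) y" xs, OF inti]
        by (simp only: avg_mult)
      then show ?thesis by simp
    qed
    also have "norm \<dots> \<le> \<delta> * measure \<rho> (space \<rho>)"
    proof (rule norm_integral_le_const[OF \<rho>(1)])
      fix l assume l: "l \<in> space \<rho>"
      have "norm (LINT k|\<rho>. c l k * avg xs (char_app (k - l)))
          \<le> (LINT k|\<rho>. norm (c l k * avg xs (char_app (k - l))))" by (rule integral_norm_bound)
      also have "\<dots> = (LINT k|\<rho>. norm (avg xs (char_app (k - l))))"
        by (simp add: norm_mult c_def del: char_app_simps)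
      also have "\<dots> \<le> \<delta>" using xs l \<rho>(2) by simp
      finally show "norm (LINT k|\<rho>. c l k * avg xs (char_app (k - l))) \<le> \<delta>" .
    qed (use \<delta> in simp)
    finally show ?thesis by (simp add: \<mu>_def \<rho>(2))
  qed
  have "\<mu>\<^sup>2 / 4 \<le> Re (avg xs (\<lambda>y. \<Sum>a\<in>A. G a y))" by (rule Re_avg_ge[OF cover])
  also have "\<dots> = (\<Sum>a\<in>A. Re (avg xs (G a)))" by (simp add: avg_sum)
  also have "\<dots> \<le> (\<Sum>a\<in>A. \<delta> * \<mu>)"
    using small complex_Re_le_cmod order_trans by (intro sum_mono) blast
  also have "\<dots> = real (card A) * (\<delta> * \<mu>)" by simp
  also have "\<dots> \<le> (real (card A) + 1) * (\<delta> * \<mu>)" using \<delta> \<mu> by (intro mult_right_mono) auto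
  also have "\<dots> = \<mu>\<^sup>2 / 8" by (simp add: \<delta>_def power2_eq_square field_simps)
  finally show False using \<mu> by simp
qed

text \<open>A compact set of positive mass has a compact part of positive mass on which one fixed
  transform is bounded below. There the small integral of \<open>|f^|\<close> squared for
  \<open>f = g - g(. - t)\<close> controls the integral of \<open>|1 - l(t)|\<close>
  squared.\<close>

lemma pure_point_of_almost_periods:
  fixes \<theta> :: "'a::{topological_ab_group_add, t2_space} measure"
  assumes lc: "locally_compact_space (euclidean :: 'a topology)" and \<theta>: "haar_measure \<theta>"
    and ft: "has_fourier_transform \<theta> \<gamma> \<nu>"
    and small: "\<And>g \<epsilon>. g \<in> Kspace \<Longrightarrow> \<epsilon> > 0 \<Longrightarrow> relatively_dense {t.
      norm (\<gamma> (fun_conv \<theta> (\<lambda>x. g x - g (x - t)) (fun_tilde (\<lambda>x. g x - g (x - t))))) \<le> \<epsilon>}"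
  shows "pure_point \<nu>"
proof (rule pure_pointI)
  show \<nu>: "radon_measure \<nu>" by (rule has_fourier_transformD(1)[OF ft])
  fix C assume C: "compact C" and atomless: "\<And>l. l \<in> C \<Longrightarrow> emeasure \<nu> {l} = 0"
  have Cs: "C \<in> sets borel" using C by (intro borel_closed compact_imp_closed)
  show "emeasure \<nu> C = 0"
  proof (rule ccontr)
    assume pos: "emeasure \<nu> C \<noteq> 0"
    have "\<forall>k. \<exists>g U c. g \<in> Kspace \<and> open U \<and> k \<in> U \<and> c > 0 \<and> (\<forall>l\<in>U. norm (fourier \<theta> g (- l)) \<ge> c)"
      by (meson exists_fourier_bounded_below[OF lc \<theta>])
    then obtain g U c where g: "\<And>k. g k \<in> Kspace" and U: "\<And>k. open (U k)" "\<And>k. k \<in> U k"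
      and c: "\<And>k. c k > 0" "\<And>k l. l \<in> U k \<Longrightarrow> norm (fourier \<theta> (g k) (- l)) \<ge> c k"
      by metis
    obtain J where J: "finite J" "C \<subseteq> (\<Union>k\<in>J. U k)"
      using compactE_image[OF C, of C U] U by (metis UN_I subsetI)
    have CU: "C \<inter> U k \<in> sets borel" for k using Cs U by auto
    have "\<exists>k\<in>J. emeasure \<nu> (C \<inter> U k) \<noteq> 0"
    proof (rule ccontr)
      assume *: "\<not> (\<exists>k\<in>J. emeasure \<nu> (C \<inter> U k) \<noteq> 0)"
      have "C = (\<Union>k\<in>J. C \<inter> U k)" using J by blast
      then have "emeasure \<nu> C \<le> (\<Sum>k\<in>J. emeasure \<nu> (C \<inter> U k))"
        using emeasure_subadditive_finite[of J "\<lambda>k. C \<inter> U k" \<nu>] J CU radon_measureD(1)[OF \<nu>] by auto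
      then show False using * pos by simp
    qed
    then obtain k where k: "emeasure \<nu> (C \<inter> U k) \<noteq> 0" by blast
    obtain D where D: "compact D" "D \<subseteq> C \<inter> U k" "emeasure \<nu> D \<noteq> 0"
      using radon_measure_inner_compact[OF \<nu> CU k] by blast
    define \<rho> where "\<rho> = restrict_space \<nu> D"
    have Ds: "D \<in> sets \<nu>"
      using D(1) radon_measureD(1)[OF \<nu>] by (auto intro: borel_closed compact_imp_closed)
    have "emeasure \<nu> D = 0"
    proof (rule almost_periodic_atomless_null[OF lc \<nu> D(1)])
      show "emeasure \<nu> {l} = 0" if "l \<in> D" for l using atomless that D by blast
      fix \<epsilon> :: real assume \<epsilon>: "\<epsilon> > 0"
      \<comment> \<open>The factor compensates the lower bound \<open>c k\<close> of the transform
        on \<open>D\<close>, by whose square the estimate is finally divided.\<close>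
      have pos: "\<epsilon> * (c k)\<^sup>2 > 0" using \<epsilon> c(1)[of k] by simp
      show "relatively_dense {t. (LINT l|restrict_space \<nu> D. (norm (1 - char_app l t))\<^sup>2) \<le> \<epsilon>}"
        unfolding \<rho>_def[symmetric]
      proof (rule relatively_dense_mono[OF small[OF g[of k] pos]], rule subsetI, unfold mem_Collect_eq)
        fix t
        define f where "f x = g k x - g k (x - t)" for x
        assume "norm (\<gamma> (fun_conv \<theta> (\<lambda>x. g k x - g k (x - t)) (fun_tilde (\<lambda>x. g k x - g k (x - t))))) \<le> \<epsilon> * (c k)\<^sup>2"
        then have le: "norm (\<gamma> (fun_conv \<theta> f (fun_tilde f))) \<le> \<epsilon> * (c k)\<^sup>2" by (simp add: f_def[abs_def])
        have f: "f \<in> Kspace" unfolding f_def by (rule Kspace_translate_diff[OF g])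
        note int = has_fourier_transformD(2)[OF ft f]
        have ff: "norm (fourier \<theta> f (- l)) = norm (1 - char_app l t) * norm (fourier \<theta> (g k) (- l))" for l
          using fourier_translate_diff[OF \<theta> g[of k], of t "- l"] unfolding f_def by (simp add: norm_mult)
        have "(c k)\<^sup>2 * (LINT l|\<rho>. (norm (1 - char_app l t))\<^sup>2) = (LINT l|\<rho>. (c k)\<^sup>2 * (norm (1 - char_app l t))\<^sup>2)"
          by simp
        also have "\<dots> = (LINT l|\<nu>. indicator D l *\<^sub>R ((c k)\<^sup>2 * (norm (1 - char_app l t))\<^sup>2))"
          unfolding \<rho>_def using Ds radon_measureD(2)[OF \<nu>] by (intro integral_restrict_space) auto
        also have "\<dots> \<le> (LINT l|\<nu>. (norm (fourier \<theta> f (- l)))\<^sup>2)"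
        proof (rule integral_mono_AE'[OF int])
          show "AE l in \<nu>. indicator D l *\<^sub>R ((c k)\<^sup>2 * (norm (1 - char_app l t))\<^sup>2) \<le> (norm (fourier \<theta> f (- l)))\<^sup>2"
          proof (rule AE_I2)
            fix l
            show "indicator D l *\<^sub>R ((c k)\<^sup>2 * (norm (1 - char_app l t))\<^sup>2) \<le> (norm (fourier \<theta> f (- l)))\<^sup>2"
            proof (cases "l \<in> D")
              case True
              then have "c k \<le> norm (fourier \<theta> (g k) (- l))" using D(2) by (intro c(2)) blast
              then have "(c k)\<^sup>2 \<le> (norm (fourier \<theta> (g k) (- l)))\<^sup>2"
                using c(1)[of k] by (intro power_mono) auto
              then have "(c k)\<^sup>2 * (norm (1 - char_app l t))\<^sup>2
                  \<le> (norm (fourier \<theta> (g k) (- l)))\<^sup>2 * (norm (1 - char_app l t))\<^sup>2"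
                by (rule mult_right_mono) simp
              then show ?thesis using True unfolding ff by (simp add: power_mult_distrib mult.commute)
            qed simp
          qed
        qed auto
        also have "\<dots> \<le> norm (\<gamma> (fun_conv \<theta> f (fun_tilde f)))"
          by (rule has_fourier_transformD(3)[OF ft f])
        also have "\<dots> \<le> \<epsilon> * (c k)\<^sup>2" by (rule le)
        finally show "(LINT l|\<rho>. (norm (1 - char_app l t))\<^sup>2) \<le> \<epsilon>"
          using c(1)[of k] by (simp add: mult.commute)
      qed
    qed
    then show False using D(3) by blast
  qed
qed

theorem theorem1:
  fixes \<theta> :: "'a::{topological_ab_group_add, t2_space} measure"
    and A :: "nat \<Rightarrow> 'a set"
    and S :: "'a set"
    and w :: "'a \<Rightarrow> complex"
    and \<eta> :: "'a \<Rightarrow> complex"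
  defines "\<Delta> \<equiv> difference_set S"
  defines "\<omega> \<equiv> dirac_comb S w"
  defines "\<gamma> \<equiv> dirac_comb \<Delta> \<eta>"
  assumes "locally_compact_space (euclidean :: 'a topology)"
    and "sigma_compact_space TYPE('a)"
    and "haar_measure \<theta>"
    and "averaging_sequence A"
    and "countable S"
    and "is_dirac_comb_measure S w"
    and "translation_bounded \<omega>"
    and "\<And>z. z \<in> \<Delta> \<Longrightarrow> (\<lambda>n. autocorr_coeff \<theta> A S w n z) \<longlonglongrightarrow> \<eta> z"
    and "\<And>z. z \<notin> \<Delta> \<Longrightarrow> \<eta> z = 0"
    and "\<eta> 0 \<in> \<real>" and "Re (\<eta> 0) > 0"
    and "closed \<Delta>" and "discrete \<Delta>"
    and "uniformly_discrete {z. \<eta> z \<noteq> 0}"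
    and "\<And>\<epsilon>. \<epsilon> > 0 \<Longrightarrow> relatively_dense {t. sqrt (norm (1 - \<eta> t / \<eta> 0)) < \<epsilon>}"
  shows "is_autocorrelation \<theta> A S w \<gamma> \<and>
         (\<forall>\<nu> :: 'a dual_group measure. has_fourier_transform \<theta> \<gamma> \<nu> \<longrightarrow>
            translation_bounded_pos \<nu> \<and> pure_point \<nu>)"
proof -
  note lc = assms(4) and \<theta> = assms(6) and lim = assms(11) and \<eta>0 = assms(12) and \<eta>_real = assms(13)
    and \<eta>_pos = assms(14) and ud = assms(17) and ap = assms(18)
  note locfin = locally_finite_of_difference_set[of S, folded \<Delta>_def, OF assms(15,16)]
  have finA: "finite (S \<inter> A n)" for n
  proof (rule finite_subset)
    show "S \<inter> A n \<subseteq> S \<inter> closure (A n)" using closure_subset by blast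
    show "finite (S \<inter> closure (A n))"
      using assms(7) unfolding averaging_sequence_def by (intro locfin(2)) blast
  qed
  \<comment> \<open>Outside the difference set the coefficients are empty sums, so the convergence
    extends to every \<open>z\<close>; Krein's inequality involves arbitrary points \<open>s\<close>
    and \<open>s + t\<close>.\<close>
  have limit: "(\<lambda>n. autocorr_coeff \<theta> A S w n z) \<longlonglongrightarrow> \<eta> z" for z
  proof (cases "z \<in> \<Delta>")
    case False
    then have "{(x, y). x \<in> S \<inter> A n \<and> y \<in> S \<inter> A n \<and> x - y = z} = {}" for n
      unfolding \<Delta>_def difference_set_def by blast
    then have "autocorr_coeff \<theta> A S w n z = 0" for n by (simp only: autocorr_coeff_def) simp
    then show ?thesis using \<eta>0[OF False] by simp
  qed (rule lim)
  have krein: "(norm (\<eta> (s + t) - \<eta> s))\<^sup>2 \<le> 2 * Re (\<eta> 0) * (Re (\<eta> 0) - Re (\<eta> t))" for s t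
    by (rule autocorr_limit_krein[OF finA limit])
  have autocorrelation: "is_autocorrelation \<theta> A S w \<gamma>"
    unfolding is_autocorrelation_def
  proof
    fix g :: "'a \<Rightarrow> complex" assume g: "g \<in> Kspace"
    define D where "D = supp g \<inter> \<Delta>"
    have D: "finite D" unfolding D_def by (rule locfin(1)[OF KspaceD(2)[OF g]])
    have off: "g z = 0" if "z \<in> \<Delta>" "z \<notin> D" for z using that KspaceD(3)[OF g] by (auto simp: D_def)
    have "\<gamma> g = (\<Sum>z\<in>D. \<eta> z * g z)"
      unfolding \<gamma>_def by (rule dirac_comb_eq_sum[OF D]) (use off in \<open>auto simp: D_def\<close>)
    moreover have "(\<lambda>n. \<Sum>z\<in>D. autocorr_coeff \<theta> A S w n z * g z) \<longlonglongrightarrow> (\<Sum>z\<in>D. \<eta> z * g z)"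
      by (intro tendsto_intros limit)
    ultimately show "(\<lambda>n. measure_conv (dirac_comb (S \<inter> A n) w) (measure_tilde (dirac_comb (S \<inter> A n) w)) g
        / complex_of_real (measure \<theta> (A n))) \<longlonglongrightarrow> \<gamma> g"
      using measure_conv_tilde_dirac_comb[where S=S and A=A, OF finA D off[unfolded \<Delta>_def]] by simp
  qed
  moreover have "translation_bounded_pos \<nu> \<and> pure_point \<nu>" if ft: "has_fourier_transform \<theta> \<gamma> \<nu>" for \<nu>
  proof
    show "translation_bounded_pos \<nu>"
    proof (rule translation_bounded_posI[OF lc \<theta> ft])
      fix g :: "'a \<Rightarrow> complex" assume g: "g \<in> Kspace"
      obtain M where M: "\<And>x. norm (g x) \<le> M" using Kspace_bounded[OF g] by blast
      define H where "H = M * (LINT y|\<theta>. norm (g y))"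
      \<comment> \<open>Depends only on the support of \<open>g\<close>, hence serves every
        \<open>g'\<close> of the same modulus.\<close>
      define D where "D = {x - y |x y. x \<in> supp g \<and> y \<in> supp g} \<inter> \<Delta>"
      have D: "finite D"
        unfolding D_def by (intro locfin(1) compact_diff_set KspaceD(2)[OF g])
      show "\<exists>B. \<forall>g'. (\<forall>x. norm (g' x) = norm (g x)) \<longrightarrow> norm (\<gamma> (fun_conv \<theta> g' (fun_tilde g'))) \<le> B"
      proof (intro exI allI impI)
        fix g' :: "'a \<Rightarrow> complex" assume g': "\<forall>x. norm (g' x) = norm (g x)"
        have off: "g' x = 0" if "x \<notin> supp g" for x
          using KspaceD(3)[OF g that] g' by (metis norm_eq_zero norm_zero)
        have "\<gamma> (fun_conv \<theta> g' (fun_tilde g')) = (\<Sum>z\<in>D. \<eta> z * fun_conv \<theta> g' (fun_tilde g') z)"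
          unfolding \<gamma>_def
        proof (rule dirac_comb_eq_sum[OF D])
          fix z assume "z \<in> \<Delta>" "z \<notin> D"
          then have "fun_conv \<theta> g' (fun_tilde g') z = 0"
            by (intro fun_conv_tilde_eq_0[of "supp g"] off) (auto simp: D_def)
          then show "\<eta> z * fun_conv \<theta> g' (fun_tilde g') z = 0" by simp
        qed (auto simp: D_def)
        also have "norm \<dots> \<le> (\<Sum>z\<in>D. norm (\<eta> z) * H)"
          unfolding H_def using norm_fun_conv_tilde_le[OF \<theta> g _ M] g'
          by (intro sum_norm_le) (auto simp: norm_mult intro!: mult_left_mono)
        finally show "norm (\<gamma> (fun_conv \<theta> g' (fun_tilde g'))) \<le> (\<Sum>z\<in>D. norm (\<eta> z) * H)" .
      qed
    qed
    show "pure_point \<nu>"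
    proof (rule pure_point_of_almost_periods[OF lc \<theta> ft])
      fix g :: "'a \<Rightarrow> complex" and \<epsilon> :: real assume g: "g \<in> Kspace" and \<epsilon>: "\<epsilon> > 0"
      define h where "h = fun_conv \<theta> g (fun_tilde g)"
      define L where "L = {x - y |x y. x \<in> supp g \<and> y \<in> supp g}"
      have L: "compact L" unfolding L_def by (intro compact_diff_set KspaceD(2)[OF g])
      have hL: "h z = 0" if "z \<notin> L" for z
        unfolding h_def using that by (intro fun_conv_tilde_eq_0[of "supp g"] KspaceD(3)[OF g]) (auto simp: L_def)
      obtain M where M: "M \<ge> 0" "\<And>x. norm (g x) \<le> M" using Kspace_bounded[OF g] by blast
      define H where "H = M * (LINT y|\<theta>. norm (g y))"
      have hH: "norm (h z) \<le> H" for z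
        unfolding h_def H_def by (rule norm_fun_conv_tilde_le[OF \<theta> g _ M(2)]) simp
      have H: "H \<ge> 0" using hH[of 0] norm_ge_zero order_trans by blast
      obtain N where N: "\<And>t. finite {z \<in> {z. \<eta> z \<noteq> 0}. z - t \<in> L}"
          "\<And>t. card {z \<in> {z. \<eta> z \<noteq> 0}. z - t \<in> L} \<le> N"
        using uniformly_discrete_card_bound[OF ud L] by blast
      define a where "a = Re (\<eta> 0)"
      have a: "a > 0" "\<eta> 0 = complex_of_real a"
        using \<eta>_pos \<eta>_real by (simp_all add: a_def)
      \<comment> \<open>The second difference of \<open>\<eta>\<close> will be at most
        \<open>4 * a * e\<close>, it is summed over at most \<open>3 * N\<close> points, and
        \<open>h\<close> is bounded by \<open>H\<close>: hence 12. The added 1 avoids a zero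
        denominator.\<close>
      define e where "e = \<epsilon> / (12 * real N * a * H + 1)"
      have den: "12 * real N * a * H + 1 > 0" using a H by (intro add_nonneg_pos mult_nonneg_nonneg) auto
      have e: "e > 0" using \<epsilon> den by (simp add: e_def)
      show "relatively_dense {t. norm (\<gamma> (fun_conv \<theta> (\<lambda>x. g x - g (x - t))
          (fun_tilde (\<lambda>x. g x - g (x - t))))) \<le> \<epsilon>}"
      proof (rule relatively_dense_mono[OF ap[OF e]], rule subsetI, unfold mem_Collect_eq)
        fix t assume "sqrt (norm (1 - \<eta> t / \<eta> 0)) < e"
        then have "norm (1 - \<eta> t / \<eta> 0) < e\<^sup>2"
          using e by (metis real_sqrt_less_iff real_sqrt_abs abs_of_pos)
        moreover have "norm (\<eta> 0 - \<eta> t) = a * norm (1 - \<eta> t / \<eta> 0)"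
        proof -
          have "\<eta> 0 - \<eta> t = \<eta> 0 * (1 - \<eta> t / \<eta> 0)" using a by (simp add: field_simps)
          then show ?thesis using a by (simp add: norm_mult)
        qed
        ultimately have "norm (\<eta> 0 - \<eta> t) \<le> a * e\<^sup>2" using a by simp
        then have "Re (\<eta> 0) - Re (\<eta> t) \<le> a * e\<^sup>2"
          using complex_Re_le_cmod[of "\<eta> 0 - \<eta> t"] by simp
        then have "2 * a * (Re (\<eta> 0) - Re (\<eta> t)) \<le> 2 * a * (a * e\<^sup>2)"
          using a by (intro mult_left_mono) auto
        \<comment> \<open>Krein gives \<open>2 * (a * e)\<^sup>2\<close>; rounding 2 up to 4 yields
          a perfect square.\<close>
        also have "\<dots> \<le> (2 * a * e)\<^sup>2" using a e by (simp add: power2_eq_square)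
        finally have le2: "2 * a * (a - Re (\<eta> t)) \<le> (2 * a * e)\<^sup>2" unfolding a_def[symmetric] .
        have diff: "norm (\<eta> (s + t) - \<eta> s) \<le> 2 * a * e" for s
        proof (rule power2_le_imp_le)
          show "(norm (\<eta> (s + t) - \<eta> s))\<^sup>2 \<le> (2 * a * e)\<^sup>2"
            using krein[of s t] le2 unfolding a_def[symmetric] by (rule order_trans)
        qed (use a e in simp)
        have "norm (2 * \<eta> z - \<eta> (z - t) - \<eta> (z + t)) \<le> 4 * a * e" for z
        proof -
          \<comment> \<open>Krein controls first differences with step \<open>t\<close> at every
            base point, so it applies at \<open>z - t\<close> and at \<open>z\<close>.\<close>
          have "2 * \<eta> z - \<eta> (z - t) - \<eta> (z + t) = (\<eta> (z - t + t) - \<eta> (z - t)) - (\<eta> (z + t) - \<eta> z)" by simp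
          then have "norm (2 * \<eta> z - \<eta> (z - t) - \<eta> (z + t))
              \<le> norm (\<eta> (z - t + t) - \<eta> (z - t)) + norm (\<eta> (z + t) - \<eta> z)"
            by (metis norm_triangle_ineq4)
          then show ?thesis using diff[of "z - t"] diff[of z] by linarith
        qed
        from dirac_comb_second_difference_le[OF \<eta>0 hL hH N this]
        have "norm (\<gamma> (\<lambda>z. 2 * h z - h (z + t) - h (z - t))) \<le> 3 * real N * (4 * a * e * H)"
          unfolding \<gamma>_def .
        also have "\<dots> = e * (12 * real N * a * H)" by simp
        also have "\<dots> \<le> e * (12 * real N * a * H + 1)" using e by simp
        also have "\<dots> = \<epsilon>" using den by (simp add: e_def)
        finally have "norm (\<gamma> (\<lambda>z. 2 * h z - h (z + t) - h (z - t))) \<le> \<epsilon>" .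
        moreover have "fun_conv \<theta> (\<lambda>x. g x - g (x - t)) (fun_tilde (\<lambda>x. g x - g (x - t)))
            = (\<lambda>z. 2 * h z - h (z + t) - h (z - t))"
          unfolding h_def by (rule ext, rule fun_conv_tilde_translate_diff[OF \<theta> g])
        ultimately show "norm (\<gamma> (fun_conv \<theta> (\<lambda>x. g x - g (x - t))
            (fun_tilde (\<lambda>x. g x - g (x - t))))) \<le> \<epsilon>" by simp
      qed
    qed
  qed
  ultimately show ?thesis by blast
qed

end
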